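(* Let $C$ be a positive bounded operator on $\ell^2=\ell^2(\mathbb{N}_0)$, with matrix $(c_{mn})_{m,n\ge 0}$, and let $\mu$ be a finite nonnegative Borel measure on $[0,1)$. Let $K_C(w,z)=\langle C\vec z,\vec w\rangle_{\ell^2}=\sum_{n\ge 0}\sum_{m\ge 0}c_{mn}\overline{w}^m z^n$ for $w,z\in\mathbb{D}$. Then $\mu\in\mathcal{M}(K_C)$ if and only if $$C\restriction_{V,\ell^2}=(C\circledast A_{\overline{e}})(S_{\overline{e}}\circledast C),$$ that is, if and only if the Abel product $S_{\overline e}\circledast C$ exists relative to $(V,L^2(\mu))$, the Abel product $C\circledast A_{\overline e}$ exists relative to $(L^2(\mu),V)$, and $\langle Cv,y\rangle_{\ell^2}=\langle (C\circledast A_{\overline e})(S_{\overline e}\circledast C)v,y\rangle_{\ell^2}$ for all $v\in V$ and $y\in\ell^2$.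
   Context: Inner products are linear in the first variable; $\mathbb{D}$ is the open unit disc. For $z\in\mathbb{D}$, $\vec z:=(z^n)_{n\ge 0}\in\ell^2$, and $V:=\mathrm{span}\{\vec v: v\in\mathbb{D}\}$ (finite linear combinations), a dense subspace of $\ell^2$, equipped with the $\ell^2$ norm. "Positive" means positive semidefinite; operators on $\ell^2$ are identified with their matrices, $(Cx)_m=\sum_n c_{mn}x_n$. For a finite nonnegative Borel measure $\mu$ on $[0,1)$ put $e_n(x)=e^{2\pi i n x}$, $\overline{e_n}=e_{-n}$ ($n\ge 0$). $S_{\overline e}:\ell^1\to L^2(\mu)$, $S_{\overline e}[(c_n)_n]=\sum_{n\ge0} c_n\overline{e_n}$ (synthesis operator), and $A_{\overline e}:L^2(\mu)\to\ell^\infty$, $A_{\overline e}f=(\langle f,\overline{e_n}\rangle_\mu)_{n\ge0}$ (analysis operator), where $\langle\cdot,\cdot\rangle_\mu$ is the inner product of $L^2(\mu)$. $\mathcal{M}(K)$: for a positive matrix (positive semidefinite kernel) $K$ on $\mathbb{D}$, $\mathcal{M}(K)$ is the set of finite nonnegative Borel measures $\mu$ on $[0,1)$ such that (i) for each fixed $w\in\mathbb{D}$ the function $K(w,\cdot)$ has an $L^2(\mu)$-boundary function $K_w^\star=K^\star(w,\cdot)\in L^2(\mu)$, meaning that $x\mapsto K(w,re^{2\pi i x})$ converges to $K_w^\star$ weakly in $L^2(\mu)$ as $r\to1^-$; and (ii) $K(w,z)=\int_0^1 K^\star(w,x)\overline{K^\star(z,x)}\,d\mu(x)$ for all $z,w\in\mathbb{D}$.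 Abel product: for $0<s<1$ let $D_s:\ell^\infty\to\ell^1$, $D_s[(x_n)_n]=(s^nx_n)_n$. Let $X$ be a subspace of an inner product space $\mathcal X$, $Y$ a subspace of an inner product space $\mathcal Y$, $S$ a (not necessarily closed) subspace of $\ell^1$, and $T_1:X\to\ell^\infty$, $T_2:S\to\mathcal Y$ linear (possibly unbounded) with $D_sT_1X\subseteq S$ for all $0<s<1$. If there is a bounded linear operator $A:X\to\mathcal Y$ (possibly the restriction to $X$ of a bounded operator on $\mathcal X$) with $\lim_{s\to1^-}\langle T_2D_sT_1x,y\rangle=\langle Ax,y\rangle$ for all $x\in X$, $y\in Y$, then $A$ is the Abel product of $T_2$ and $T_1$ relative to $(X,Y)$, written $T_2\circledast T_1=A\restriction_{X,Y}$. Here $S_{\overline e}\circledast C$ is taken with $T_1=C|_V:V\to\ell^2\subset\ell^\infty$, $T_2=S_{\overline e}$ on $\ell^1$, $X=V\subset\ell^2$, $Y=\mathcal Y=L^2(\mu)$; and $C\circledast A_{\overline e}$ is taken with $T_1=A_{\overline e}$, $T_2=C:\ell^1\to\ell^2$, $X=\mathcal X=L^2(\mu)$, $Y=V\subset\mathcal Y=\ell^2$. *)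

theory Defs
  imports "HOL-Analysis.Analysis"
begin

text \<open>
  Elements of \<open>L\<^sup>2(M)\<close> are represented by functions; equality in \<open>L\<^sup>2(M)\<close> is equality almost
  everywhere. The inner product is linear in the first argument.
\<close>

definition L2 :: "'a measure \<Rightarrow> ('a \<Rightarrow> complex) set" where
  "L2 M = {f \<in> borel_measurable M. integrable M (\<lambda>x. (cmod (f x))\<^sup>2)}"

definition L2_inner :: "'a measure \<Rightarrow> ('a \<Rightarrow> complex) \<Rightarrow> ('a \<Rightarrow> complex) \<Rightarrow> complex" where
  "L2_inner M f g = (LINT x|M. f x * cnj (g x))"

definition L2_norm :: "'a measure \<Rightarrow> ('a \<Rightarrow> complex) \<Rightarrow> real" where
  "L2_norm M f = sqrt (LINT x|M. (cmod (f x))\<^sup>2)"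

text \<open>
  For counting measure, almost everywhere equality is equality, and the integrals are the usual
  series (lemmas \<open>ell2_iff\<close>, \<open>ell2_inner_eq\<close>, \<open>ell2_norm_eq\<close> below).
\<close>

abbreviation cnt :: "nat measure" where
  "cnt \<equiv> count_space UNIV"

abbreviation ell2 :: "(nat \<Rightarrow> complex) set" where
  "ell2 \<equiv> L2 cnt"

abbreviation ell2_inner :: "(nat \<Rightarrow> complex) \<Rightarrow> (nat \<Rightarrow> complex) \<Rightarrow> complex" where
  "ell2_inner \<equiv> L2_inner cnt"

definition ell1 :: "(nat \<Rightarrow> complex) set" where
  "ell1 = {x. summable (\<lambda>n. cmod (x n))}"

definition ell_inf :: "(nat \<Rightarrow> complex) set" where
  "ell_inf = {x. bounded (range x)}"

definition power_vec :: "complex \<Rightarrow> nat \<Rightarrow> complex" where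
  "power_vec z = (\<lambda>n. z ^ n)"

definition V_space :: "(nat \<Rightarrow> complex) set" where
  "V_space = {\<lambda>n. \<Sum>v\<in>F. a v * power_vec v n | F a. finite F \<and> F \<subseteq> ball 0 1}"

definition unit_vec :: "nat \<Rightarrow> nat \<Rightarrow> complex" where
  "unit_vec k = (\<lambda>n. if n = k then 1 else 0)"

definition csubspace_fun :: "('a \<Rightarrow> complex) set \<Rightarrow> bool" where
  "csubspace_fun X \<longleftrightarrow> (\<lambda>_. 0) \<in> X \<and>
     (\<forall>f\<in>X. \<forall>g\<in>X. \<forall>a b. (\<lambda>i. a * f i + b * g i) \<in> X)"

text \<open>
  \<open>linear_map M X N W T\<close>: \<open>T\<close> induces a linear map from \<open>X\<close> (functions modulo \<open>M\<close>-null sets) to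
  \<open>W\<close> (functions modulo \<open>N\<close>-null sets). Values of \<open>T\<close> outside \<open>X\<close> are irrelevant.
\<close>

definition linear_map ::
  "'a measure \<Rightarrow> ('a \<Rightarrow> complex) set \<Rightarrow> 'b measure \<Rightarrow> ('b \<Rightarrow> complex) set \<Rightarrow>
     (('a \<Rightarrow> complex) \<Rightarrow> ('b \<Rightarrow> complex)) \<Rightarrow> bool" where
  "linear_map M X N W T \<longleftrightarrow>
     (\<forall>f\<in>X. T f \<in> W) \<and>
     (\<forall>f\<in>X. \<forall>g\<in>X. (AE i in M. f i = g i) \<longrightarrow> (AE k in N. T f k = T g k)) \<and>
     (\<forall>f\<in>X. \<forall>g\<in>X. \<forall>a b. AE k in N. T (\<lambda>i. a * f i + b * g i) k = a * T f k + b * T g k)"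

definition bounded_linear_map ::
  "'a measure \<Rightarrow> ('a \<Rightarrow> complex) set \<Rightarrow> 'b measure \<Rightarrow>
     (('a \<Rightarrow> complex) \<Rightarrow> ('b \<Rightarrow> complex)) \<Rightarrow> bool" where
  "bounded_linear_map M X N T \<longleftrightarrow>
     linear_map M X N (L2 N) T \<and> (\<exists>B. \<forall>f\<in>X. L2_norm N (T f) \<le> B * L2_norm M f)"

definition bounded_op_ell2 :: "((nat \<Rightarrow> complex) \<Rightarrow> (nat \<Rightarrow> complex)) \<Rightarrow> bool" where
  "bounded_op_ell2 C \<longleftrightarrow> bounded_linear_map cnt ell2 cnt C"

definition positive_op_ell2 :: "((nat \<Rightarrow> complex) \<Rightarrow> (nat \<Rightarrow> complex)) \<Rightarrow> bool" where
  "positive_op_ell2 C \<longleftrightarrow> (\<forall>x\<in>ell2. ell2_inner (C x) x \<in> \<real>\<^sub>\<ge>\<^sub>0)"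

text \<open>The matrix entry \<open>c\<^sub>m\<^sub>n\<close>; see lemma \<open>op_matrix_sums\<close>.\<close>

definition op_matrix :: "((nat \<Rightarrow> complex) \<Rightarrow> (nat \<Rightarrow> complex)) \<Rightarrow> nat \<Rightarrow> nat \<Rightarrow> complex" where
  "op_matrix C m n = C (unit_vec n) m"

text \<open>Lemma \<open>op_kernel_eq_double_series\<close> gives the expansion in terms of the matrix.\<close>

definition op_kernel ::
  "((nat \<Rightarrow> complex) \<Rightarrow> (nat \<Rightarrow> complex)) \<Rightarrow> complex \<Rightarrow> complex \<Rightarrow> complex" where
  "op_kernel C w z = ell2_inner (C (power_vec z)) (power_vec w)"

definition finite_borel_01 :: "real measure \<Rightarrow> bool" where
  "finite_borel_01 M \<longleftrightarrow>
     finite_measure M \<and> sets M = sets (restrict_space borel {0..<1})"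

definition fourier :: "nat \<Rightarrow> real \<Rightarrow> complex" where
  "fourier n x = cis (2 * pi * real n * x)"

text \<open>The series defining the synthesis operator converges uniformly on \<open>ell1\<close>.\<close>

definition synthesis_conj :: "(nat \<Rightarrow> complex) \<Rightarrow> real \<Rightarrow> complex" where
  "synthesis_conj c = (\<lambda>x. \<Sum>n. c n * cnj (fourier n x))"

definition analysis_conj :: "real measure \<Rightarrow> (real \<Rightarrow> complex) \<Rightarrow> nat \<Rightarrow> complex" where
  "analysis_conj M f = (\<lambda>n. L2_inner M f (\<lambda>x. cnj (fourier n x)))"

text \<open>\<open>g\<close> is the \<open>L\<^sup>2(M)\<close>-boundary function of \<open>F\<close>, as a weak radial limit.\<close>

definition has_L2_boundary ::
  "real measure \<Rightarrow> (complex \<Rightarrow> complex) \<Rightarrow> (real \<Rightarrow> complex) \<Rightarrow> bool" where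
  "has_L2_boundary M F g \<longleftrightarrow>
     g \<in> L2 M \<and>
     (\<forall>r\<in>{0<..<1}. (\<lambda>x. F (of_real r * cis (2 * pi * x))) \<in> L2 M) \<and>
     (\<forall>h\<in>L2 M. ((\<lambda>r. L2_inner M (\<lambda>x. F (of_real r * cis (2 * pi * x))) h)
                  \<longlongrightarrow> L2_inner M g h) (at_left 1))"

text \<open>The set \<open>\<M>(K)\<close>, meant for positive semidefinite kernels \<open>K\<close> on the open unit disc.\<close>

definition boundary_measures :: "(complex \<Rightarrow> complex \<Rightarrow> complex) \<Rightarrow> real measure set" where
  "boundary_measures K = {M. finite_borel_01 M \<and>
     (\<exists>Kstar. (\<forall>w\<in>ball 0 1. has_L2_boundary M (K w) (Kstar w)) \<and>
        (\<forall>z\<in>ball 0 1. \<forall>w\<in>ball 0 1. K w z = (LINT x|M. Kstar w x * cnj (Kstar z x))))}"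

definition abel_scale :: "real \<Rightarrow> (nat \<Rightarrow> complex) \<Rightarrow> nat \<Rightarrow> complex" where
  "abel_scale s x = (\<lambda>n. of_real (s ^ n) * x n)"

text \<open>
  \<open>is_abel_product M X N Y S T2 T1 A\<close>: the operator \<open>A\<close> is the Abel product of
  \<open>T2 : S \<rightarrow> L\<^sup>2(N)\<close> and \<open>T1 : X \<rightarrow> \<ell>\<^sup>\<infinity>\<close> relative to \<open>(X, Y)\<close>, where \<open>X\<close> is a subspace of
  \<open>L\<^sup>2(M)\<close> with its norm and \<open>Y\<close> a subspace of \<open>L\<^sup>2(N)\<close>.
\<close>

definition is_abel_product ::
  "'a measure \<Rightarrow> ('a \<Rightarrow> complex) set \<Rightarrow> 'b measure \<Rightarrow> ('b \<Rightarrow> complex) set \<Rightarrow>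
   (nat \<Rightarrow> complex) set \<Rightarrow>
   ((nat \<Rightarrow> complex) \<Rightarrow> ('b \<Rightarrow> complex)) \<Rightarrow> (('a \<Rightarrow> complex) \<Rightarrow> (nat \<Rightarrow> complex)) \<Rightarrow>
   (('a \<Rightarrow> complex) \<Rightarrow> ('b \<Rightarrow> complex)) \<Rightarrow> bool" where
  "is_abel_product M X N Y S T2 T1 A \<longleftrightarrow>
     csubspace_fun X \<and> X \<subseteq> L2 M \<and> csubspace_fun Y \<and> Y \<subseteq> L2 N \<and>
     csubspace_fun S \<and> S \<subseteq> ell1 \<and>
     linear_map M X cnt ell_inf T1 \<and> linear_map cnt S N (L2 N) T2 \<and>
     (\<forall>s\<in>{0<..<1}. \<forall>x\<in>X. abel_scale s (T1 x) \<in> S) \<and>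
     bounded_linear_map M X N A \<and>
     (\<forall>x\<in>X. \<forall>y\<in>Y. ((\<lambda>s. L2_inner N (T2 (abel_scale s (T1 x))) y)
                      \<longlongrightarrow> L2_inner N (A x) y) (at_left 1))"

lemma ell2_iff: "x \<in> ell2 \<longleftrightarrow> summable (\<lambda>n. (cmod (x n))\<^sup>2)"
  by (simp add: L2_def integrable_count_space_nat_iff)

lemma ell2_inner_integrable:
  assumes "x \<in> ell2" "y \<in> ell2"
  shows "integrable cnt (\<lambda>n. x n * cnj (y n))"
proof -
  have "summable (\<lambda>n. (cmod (x n))\<^sup>2 + (cmod (y n))\<^sup>2)"
    using assms by (intro summable_add) (simp_all add: ell2_iff)
  moreover have "cmod (x n) * cmod (y n) \<le> (cmod (x n))\<^sup>2 + (cmod (y n))\<^sup>2" for n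
    using sum_squares_bound[of "cmod (x n)" "cmod (y n)"]
      mult_nonneg_nonneg[OF norm_ge_zero[of "x n"] norm_ge_zero[of "y n"]] by linarith
  ultimately have "summable (\<lambda>n. cmod (x n) * cmod (y n))"
    by - (rule summable_comparison_test'[where N = 0], assumption, simp)
  then show ?thesis
    by (simp add: integrable_count_space_nat_iff norm_mult)
qed

lemma ell2_inner_eq:
  assumes "x \<in> ell2" "y \<in> ell2"
  shows "ell2_inner x y = (\<Sum>n. x n * cnj (y n))"
  unfolding L2_inner_def by (rule integral_count_space_nat[OF ell2_inner_integrable[OF assms]])

lemma ell2_norm_eq:
  assumes "x \<in> ell2"
  shows "L2_norm cnt x = sqrt (\<Sum>n. (cmod (x n))\<^sup>2)"
  using assms integral_count_space_nat[of "\<lambda>n. (cmod (x n))\<^sup>2"]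
  by (simp add: L2_norm_def L2_def)

lemma power_vec_ell2:
  assumes "z \<in> ball 0 1"
  shows "power_vec z \<in> ell2"
proof -
  have "(cmod z)\<^sup>2 < 1"
    using assms by (simp add: abs_square_less_1)
  then have "summable (\<lambda>n. ((cmod z)\<^sup>2) ^ n)"
    by (intro summable_geometric) simp
  moreover have "((cmod z)\<^sup>2) ^ n = (cmod (power_vec z n))\<^sup>2" for n
    by (simp only: power_vec_def norm_power power_mult[symmetric] mult.commute[of 2 n])
  ultimately show ?thesis
    by (simp only: ell2_iff)
qed

lemma unit_vec_ell2: "unit_vec k \<in> ell2"
  unfolding ell2_iff
  by (rule summable_finite[of "{k}"]) (auto simp: unit_vec_def)

lemma ell2_lincomb:
  assumes "f \<in> ell2" "g \<in> ell2"
  shows "(\<lambda>i. a * f i + b * g i) \<in> ell2"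
proof -
  have "summable (\<lambda>n. 2 * (cmod a)\<^sup>2 * (cmod (f n))\<^sup>2 + 2 * (cmod b)\<^sup>2 * (cmod (g n))\<^sup>2)"
    using assms by (intro summable_add summable_mult) (simp_all add: ell2_iff)
  moreover have "(cmod (a * f n + b * g n))\<^sup>2
      \<le> 2 * (cmod a)\<^sup>2 * (cmod (f n))\<^sup>2 + 2 * (cmod b)\<^sup>2 * (cmod (g n))\<^sup>2" for n
  proof -
    have "(cmod (a * f n + b * g n))\<^sup>2 \<le> (cmod a * cmod (f n) + cmod b * cmod (g n))\<^sup>2"
      by (intro power_mono) (metis norm_mult norm_triangle_ineq, simp)
    also have "\<dots> \<le> 2 * (cmod a * cmod (f n))\<^sup>2 + 2 * (cmod b * cmod (g n))\<^sup>2"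
      using sum_squares_bound[of "cmod a * cmod (f n)" "cmod b * cmod (g n)"]
      by (simp add: power2_sum)
    finally show ?thesis by (simp add: power_mult_distrib)
  qed
  ultimately show ?thesis
    unfolding ell2_iff
    by - (rule summable_comparison_test'[where N = 0], assumption, simp)
qed

lemma bounded_functional_sums:
  fixes \<phi> :: "(nat \<Rightarrow> complex) \<Rightarrow> complex"
  assumes lin: "\<And>f g a b. f \<in> ell2 \<Longrightarrow> g \<in> ell2 \<Longrightarrow>
      \<phi> (\<lambda>i. a * f i + b * g i) = a * \<phi> f + b * \<phi> g"
    and bd: "\<And>f. f \<in> ell2 \<Longrightarrow> cmod (\<phi> f) \<le> B * L2_norm cnt f"
    and x: "x \<in> ell2"
  shows "(\<lambda>n. x n * \<phi> (unit_vec n)) sums \<phi> x"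
proof -
  define t where "t N = (\<lambda>n. if n < N then x n else 0)" for N
  have t_mem: "t N \<in> ell2" for N
    unfolding ell2_iff by (rule summable_finite[of "{..<N}"]) (auto simp: t_def)
  have zero: "\<phi> (\<lambda>i. 0) = 0"
    using lin[OF x x, of 0 0] by simp
  have trunc: "\<phi> (t N) = (\<Sum>n<N. x n * \<phi> (unit_vec n))" for N
  proof (induction N)
    case 0
    then show ?case using zero by (simp add: t_def)
  next
    case (Suc N)
    have "t (Suc N) = (\<lambda>i. 1 * t N i + x N * unit_vec N i)"
      by (rule ext) (auto simp: t_def unit_vec_def less_Suc_eq)
    then have "\<phi> (t (Suc N)) = 1 * \<phi> (t N) + x N * \<phi> (unit_vec N)"
      by (simp only: lin[OF t_mem unit_vec_ell2])
    then show ?case using Suc by simp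
  qed
  define f where "f n = (cmod (x n))\<^sup>2" for n
  have sf: "summable f" using x by (simp add: ell2_iff f_def[abs_def])
  have err: "cmod (\<phi> (t N) - \<phi> x) \<le> B * sqrt (suminf f - sum f {..<N})" for N
  proof -
    define d where "d = (\<lambda>i. 1 * t N i + (-1) * x i)"
    have d: "d \<in> ell2" unfolding d_def by (rule ell2_lincomb[OF t_mem x])
    have "(\<lambda>n. f n - (if n < N then f n else 0)) sums (suminf f - sum f {..<N})"
      using sums_If_finite_set[of "{..<N}" f] sf
      by (intro sums_diff summable_sums) simp_all
    moreover have "(\<lambda>n. f n - (if n < N then f n else 0)) = (\<lambda>n. (cmod (d n))\<^sup>2)"
      by (rule ext) (simp add: d_def t_def f_def)
    ultimately have "L2_norm cnt d = sqrt (suminf f - sum f {..<N})"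
      by (simp add: ell2_norm_eq[OF d] sums_iff)
    moreover have "\<phi> d = \<phi> (t N) - \<phi> x"
      unfolding d_def using lin[OF t_mem x, of 1 N "-1"] by simp
    ultimately show ?thesis using bd[OF d] by simp
  qed
  have "(\<lambda>N. B * sqrt (suminf f - sum f {..<N})) \<longlonglongrightarrow> B * sqrt (suminf f - suminf f)"
    by (rule tendsto_mult[OF tendsto_const
          tendsto_real_sqrt[OF tendsto_diff[OF tendsto_const summable_LIMSEQ[OF sf]]]])
  then have lim: "(\<lambda>N. B * sqrt (suminf f - sum f {..<N})) \<longlonglongrightarrow> 0"
    by simp
  have "(\<lambda>N. \<phi> (t N) - \<phi> x) \<longlonglongrightarrow> 0"
    by (rule Lim_null_comparison[OF always_eventually lim]) (use err in blast)
  then have "(\<lambda>N. \<phi> (t N)) \<longlonglongrightarrow> \<phi> x"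
    by (rule LIM_zero_cancel)
  then show ?thesis by (simp add: sums_def trunc)
qed

lemma ell2_op_mem: "C f \<in> ell2" if "bounded_op_ell2 C" "f \<in> ell2"
  using that unfolding bounded_op_ell2_def bounded_linear_map_def linear_map_def by blast

lemma ell2_op_lincomb:
  assumes "bounded_op_ell2 C" "f \<in> ell2" "g \<in> ell2"
  shows "C (\<lambda>i. a * f i + b * g i) k = a * C f k + b * C g k"
proof -
  have "AE k in cnt. C (\<lambda>i. a * f i + b * g i) k = a * C f k + b * C g k"
    using assms unfolding bounded_op_ell2_def bounded_linear_map_def linear_map_def by blast
  then show ?thesis by (simp add: AE_count_space)
qed

lemma ell2_op_bound:
  assumes "bounded_op_ell2 C"
  shows "\<exists>B. \<forall>f\<in>ell2. L2_norm cnt (C f) \<le> B * L2_norm cnt f"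
  using assms unfolding bounded_op_ell2_def bounded_linear_map_def by blast

lemma ell2_inner_le:
  assumes "x \<in> ell2" "y \<in> ell2"
  shows "cmod (ell2_inner x y) \<le> L2_norm cnt x * L2_norm cnt y"
proof -
  have sx: "summable (\<lambda>n. (cmod (x n))\<^sup>2)" and sy: "summable (\<lambda>n. (cmod (y n))\<^sup>2)"
    using assms by (simp_all add: ell2_iff)
  have s: "summable (\<lambda>n. cmod (x n * cnj (y n)))"
    using ell2_inner_integrable[OF assms] by (simp add: integrable_count_space_nat_iff)
  have "(\<Sum>n<N. cmod (x n * cnj (y n))) \<le> L2_norm cnt x * L2_norm cnt y" for N
  proof -
    have "(\<Sum>n<N. cmod (x n * cnj (y n)))
        \<le> L2_set (\<lambda>n. cmod (x n)) {..<N} * L2_set (\<lambda>n. cmod (y n)) {..<N}"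
      using L2_set_mult_ineq[of "\<lambda>n. cmod (x n)" "\<lambda>n. cmod (y n)" "{..<N}"]
      by (simp add: norm_mult)
    also have "\<dots> \<le> L2_norm cnt x * L2_norm cnt y"
      unfolding L2_set_def ell2_norm_eq[OF assms(1)] ell2_norm_eq[OF assms(2)]
      by (intro mult_mono real_sqrt_le_mono sum_le_suminf sx sy real_sqrt_ge_zero
            suminf_nonneg sum_nonneg) simp_all
    finally show ?thesis .
  qed
  then have "(\<Sum>n. cmod (x n * cnj (y n))) \<le> L2_norm cnt x * L2_norm cnt y"
    by (intro suminf_le_const s)
  then show ?thesis
    using summable_norm[OF s] by (simp add: ell2_inner_eq[OF assms])
qed

lemma ell2_coord_eq_inner:
  assumes "x \<in> ell2"
  shows "x m = ell2_inner x (unit_vec m)"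
proof -
  have "(\<lambda>n. x n * cnj (unit_vec m n)) sums (\<Sum>n\<in>{m}. x n * cnj (unit_vec m n))"
    by (rule sums_finite) (auto simp: unit_vec_def)
  then have "(\<Sum>n. x n * cnj (unit_vec m n)) = x m"
    by (simp add: sums_iff) (simp add: unit_vec_def)
  then show ?thesis
    by (simp only: ell2_inner_eq[OF assms unit_vec_ell2])
qed

lemma ell2_op_form_sums:
  assumes C: "bounded_op_ell2 C" and x: "x \<in> ell2" and y: "y \<in> ell2"
  shows "(\<lambda>n. x n * ell2_inner (C (unit_vec n)) y) sums ell2_inner (C x) y"
proof -
  obtain B where B: "\<And>f. f \<in> ell2 \<Longrightarrow> L2_norm cnt (C f) \<le> B * L2_norm cnt f"
    using ell2_op_bound[OF C] by blast
  show ?thesis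
  proof (rule bounded_functional_sums[where \<phi> = "\<lambda>f. ell2_inner (C f) y"
        and B = "B * L2_norm cnt y", OF _ _ x])
    fix f g :: "nat \<Rightarrow> complex" and a b :: complex
    assume f: "f \<in> ell2" and g: "g \<in> ell2"
    have "ell2_inner (C (\<lambda>i. a * f i + b * g i)) y
        = (LINT n|cnt. a * (C f n * cnj (y n)) + b * (C g n * cnj (y n)))"
      unfolding L2_inner_def
      by (intro Bochner_Integration.integral_cong refl)
        (simp add: ell2_op_lincomb[OF C f g] algebra_simps)
    also have "\<dots> = a * ell2_inner (C f) y + b * ell2_inner (C g) y"
      unfolding L2_inner_def
      using ell2_inner_integrable[OF ell2_op_mem[OF C f] y]
        ell2_inner_integrable[OF ell2_op_mem[OF C g] y]
      by (subst Bochner_Integration.integral_add) auto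
    finally show "ell2_inner (C (\<lambda>i. a * f i + b * g i)) y
        = a * ell2_inner (C f) y + b * ell2_inner (C g) y" .
  next
    fix f :: "nat \<Rightarrow> complex"
    assume f: "f \<in> ell2"
    have "cmod (ell2_inner (C f) y) \<le> L2_norm cnt (C f) * L2_norm cnt y"
      by (rule ell2_inner_le[OF ell2_op_mem[OF C f] y])
    also have "\<dots> \<le> B * L2_norm cnt f * L2_norm cnt y"
      by (intro mult_right_mono B f) (simp add: L2_norm_def)
    finally show "cmod (ell2_inner (C f) y) \<le> B * L2_norm cnt y * L2_norm cnt f"
      by (simp add: mult_ac)
  qed
qed

lemma op_matrix_sums:
  assumes C: "bounded_op_ell2 C" and x: "x \<in> ell2"
  shows "(\<lambda>n. op_matrix C m n * x n) sums C x m"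
proof -
  have "ell2_inner (C x) (unit_vec m) = C x m"
    by (rule ell2_coord_eq_inner[OF ell2_op_mem[OF C x], symmetric])
  moreover have "ell2_inner (C (unit_vec n)) (unit_vec m) = op_matrix C m n" for n
    unfolding op_matrix_def
    by (rule ell2_coord_eq_inner[OF ell2_op_mem[OF C unit_vec_ell2], symmetric])
  ultimately show ?thesis
    using ell2_op_form_sums[OF C x unit_vec_ell2[of m]] by (simp only: mult.commute)
qed

lemma op_kernel_eq_double_series:
  assumes C: "bounded_op_ell2 C" and "w \<in> ball 0 1" "z \<in> ball 0 1"
  shows "op_kernel C w z = (\<Sum>n. \<Sum>m. op_matrix C m n * cnj w ^ m * z ^ n)"
proof -
  have "z ^ n * ell2_inner (C (unit_vec n)) (power_vec w)
      = (\<Sum>m. op_matrix C m n * cnj w ^ m * z ^ n)" for n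
  proof -
    have mem: "C (unit_vec n) \<in> ell2" "power_vec w \<in> ell2"
      using assms by (auto intro: ell2_op_mem unit_vec_ell2 power_vec_ell2)
    have "summable (\<lambda>m. C (unit_vec n) m * cnj (power_vec w m))"
      using ell2_inner_integrable[OF mem]
      by (auto simp: integrable_count_space_nat_iff dest: summable_norm_cancel)
    then have "(\<Sum>m. C (unit_vec n) m * cnj (power_vec w m) * z ^ n)
        = (\<Sum>m. C (unit_vec n) m * cnj (power_vec w m)) * z ^ n"
      by (rule suminf_mult2[symmetric])
    then have "ell2_inner (C (unit_vec n)) (power_vec w) * z ^ n
        = (\<Sum>m. C (unit_vec n) m * cnj (power_vec w m) * z ^ n)"
      by (simp only: ell2_inner_eq[OF mem])
    then show ?thesis
      by (simp add: op_matrix_def power_vec_def mult.commute[of "z ^ n"])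
  qed
  moreover have "op_kernel C w z = (\<Sum>n. z ^ n * ell2_inner (C (unit_vec n)) (power_vec w))"
    using ell2_op_form_sums[OF C power_vec_ell2 power_vec_ell2, of z w] assms
    by (simp add: op_kernel_def power_vec_def sums_iff)
  ultimately show ?thesis by simp
qed

end

theory Submission
  imports Defs
begin

text \<open>
  Since \<open>C\<close> is self-adjoint, \<open>K\<^sub>C(w, r e\<^sup>2\<^sup>\<pi>\<^sup>i\<^sup>x)\<close> is the complex conjugate of
  \<open>(S D\<^sub>r C w)(x)\<close>, where \<open>S\<close> is the synthesis operator and \<open>w\<close> stands for its power vector.
  Boundary functions of \<open>K\<^sub>C(w, \<cdot>)\<close> are therefore the conjugates of weak Abel limits \<open>A w\<close>, and
  the reproducing identity says \<open>\<langle>A z, A w\<rangle> = \<langle>C z, w\<rangle>\<close>. This identity extends to the span \<open>V\<close>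
  of the power vectors and makes \<open>A\<close> bounded there. As \<open>\<langle>C D\<^sub>s A\<^sub>e f, v\<rangle> = \<langle>f, S D\<^sub>s C v\<rangle>\<close>, with
  \<open>A\<^sub>e\<close> the analysis operator, the second Abel product \<open>B\<close> can only be the adjoint of \<open>A\<close>; it exists
  by Riesz representation on the dense subspace \<open>V\<close>, and \<open>C = B A\<close> on \<open>V\<close> is the reproducing
  identity again.
\<close>

subsection \<open>The space of square-integrable functions\<close>

lemma borel_measurable_cnj [measurable]:
  assumes "f \<in> borel_measurable M"
  shows "(\<lambda>x. cnj (f x)) \<in> borel_measurable M"
  by (rule measurable_compose[OF assms borel_measurable_continuous_onI])
    (intro continuous_intros)

lemma L2_measurable: "f \<in> L2 M \<Longrightarrow> f \<in> borel_measurable M"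
  by (simp add: L2_def)

lemma L2_integrable_sq: "f \<in> L2 M \<Longrightarrow> integrable M (\<lambda>x. (cmod (f x))\<^sup>2)"
  by (simp add: L2_def)

lemma L2_I_bound:
  assumes "f \<in> borel_measurable M" "integrable M g" "\<And>x. (cmod (f x))\<^sup>2 \<le> g x"
  shows "f \<in> L2 M"
  unfolding L2_def
proof (intro CollectI conjI)
  show "integrable M (\<lambda>x. (cmod (f x))\<^sup>2)"
  proof (rule Bochner_Integration.integrable_bound[OF assms(2)])
    show "AE x in M. norm ((cmod (f x))\<^sup>2) \<le> norm (g x)"
      using assms(3) by (intro AE_I2) (smt (verit) real_norm_def zero_le_power2)
  qed (use assms(1) in measurable)
qed (fact assms(1))

lemma L2_lincomb:
  assumes "f \<in> L2 M" "g \<in> L2 M"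
  shows "(\<lambda>x. a * f x + b * g x) \<in> L2 M"
proof (rule L2_I_bound)
  show "(\<lambda>x. a * f x + b * g x) \<in> borel_measurable M"
    using assms[THEN L2_measurable] by measurable
  show "integrable M (\<lambda>x. 2 * (cmod a)\<^sup>2 * (cmod (f x))\<^sup>2 + 2 * (cmod b)\<^sup>2 * (cmod (g x))\<^sup>2)"
    using assms by (intro Bochner_Integration.integrable_add integrable_mult_right)
      (simp_all add: L2_integrable_sq)
  show "(cmod (a * f x + b * g x))\<^sup>2
      \<le> 2 * (cmod a)\<^sup>2 * (cmod (f x))\<^sup>2 + 2 * (cmod b)\<^sup>2 * (cmod (g x))\<^sup>2" for x
  proof -
    have "(cmod (a * f x + b * g x))\<^sup>2 \<le> (cmod a * cmod (f x) + cmod b * cmod (g x))\<^sup>2"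
      by (intro power_mono) (metis norm_mult norm_triangle_ineq, simp)
    also have "\<dots> \<le> 2 * (cmod a * cmod (f x))\<^sup>2 + 2 * (cmod b * cmod (g x))\<^sup>2"
      using sum_squares_bound[of "cmod a * cmod (f x)" "cmod b * cmod (g x)"]
      by (simp add: power2_sum)
    finally show ?thesis by (simp add: power_mult_distrib)
  qed
qed

lemma L2_zero: "(\<lambda>_. 0) \<in> L2 M"
  by (simp add: L2_def)

lemma csubspace_L2: "csubspace_fun (L2 M)"
  unfolding csubspace_fun_def using L2_lincomb L2_zero by blast

lemma L2_cnj: "f \<in> L2 M \<Longrightarrow> (\<lambda>x. cnj (f x)) \<in> L2 M"
  by (auto simp: L2_def borel_measurable_cnj)

lemma L2_diff:
  assumes "f \<in> L2 M" "g \<in> L2 M"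
  shows "(\<lambda>x. f x - g x) \<in> L2 M"
  using L2_lincomb[OF assms, of 1 "-1"] by simp

lemma L2_inner_integrable:
  assumes "f \<in> L2 M" "g \<in> L2 M"
  shows "integrable M (\<lambda>x. f x * cnj (g x))"
proof (rule Bochner_Integration.integrable_bound)
  show "integrable M (\<lambda>x. (cmod (f x))\<^sup>2 + (cmod (g x))\<^sup>2)"
    using assms by (simp add: L2_integrable_sq)
  show "(\<lambda>x. f x * cnj (g x)) \<in> borel_measurable M"
    using assms[THEN L2_measurable] by measurable
  have "cmod (f x) * cmod (g x) \<le> (cmod (f x))\<^sup>2 + (cmod (g x))\<^sup>2" for x
    using sum_squares_bound[of "cmod (f x)" "cmod (g x)"]
      mult_nonneg_nonneg[OF norm_ge_zero[of "f x"] norm_ge_zero[of "g x"]] by linarith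
  then show "AE x in M. norm (f x * cnj (g x)) \<le> norm ((cmod (f x))\<^sup>2 + (cmod (g x))\<^sup>2)"
    by (simp add: norm_mult)
qed

lemma L2_inner_lincomb_left:
  assumes "f \<in> L2 M" "g \<in> L2 M" "h \<in> L2 M"
  shows "L2_inner M (\<lambda>x. a * f x + b * g x) h = a * L2_inner M f h + b * L2_inner M g h"
proof -
  have "L2_inner M (\<lambda>x. a * f x + b * g x) h
      = (LINT x|M. a * (f x * cnj (h x)) + b * (g x * cnj (h x)))"
    unfolding L2_inner_def by (simp add: algebra_simps)
  also have "\<dots> = a * L2_inner M f h + b * L2_inner M g h"
    unfolding L2_inner_def
    using L2_inner_integrable[OF assms(1,3)] L2_inner_integrable[OF assms(2,3)]
    by (subst Bochner_Integration.integral_add) auto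
  finally show ?thesis .
qed

lemma L2_inner_cnj: "cnj (L2_inner M f g) = L2_inner M g f"
  unfolding L2_inner_def by (simp flip: Bochner_Integration.integral_cnj add: mult.commute)

lemma L2_inner_cnj_cnj: "L2_inner M (\<lambda>x. cnj (f x)) (\<lambda>x. cnj (g x)) = cnj (L2_inner M f g)"
  unfolding L2_inner_def by (simp flip: Bochner_Integration.integral_cnj)

lemma L2_inner_lincomb_right:
  assumes "f \<in> L2 M" "g \<in> L2 M" "h \<in> L2 M"
  shows "L2_inner M h (\<lambda>x. a * f x + b * g x)
    = cnj a * L2_inner M h f + cnj b * L2_inner M h g"
  using arg_cong[OF L2_inner_lincomb_left[OF assms, of a b], of cnj] by (simp add: L2_inner_cnj)

lemma L2_inner_zero: "L2_inner M (\<lambda>_. 0) h = 0" "L2_inner M h (\<lambda>_. 0) = 0"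
  by (simp_all add: L2_inner_def)

lemma L2_inner_cong_AE:
  assumes "f \<in> L2 M" "f' \<in> L2 M" "h \<in> L2 M" "AE x in M. f x = f' x"
  shows "L2_inner M f h = L2_inner M f' h"
  unfolding L2_inner_def
  by (intro integral_cong_AE borel_measurable_integrable L2_inner_integrable assms)
    (use assms(4) in auto)

lemma L2_norm_nonneg: "0 \<le> L2_norm M f"
  by (simp add: L2_norm_def)

lemma L2_norm_sq: "(L2_norm M f)\<^sup>2 = (LINT x|M. (cmod (f x))\<^sup>2)"
  by (simp add: L2_norm_def)

lemma L2_inner_self: "L2_inner M f f = of_real ((L2_norm M f)\<^sup>2)"
  unfolding L2_inner_def L2_norm_sq by (simp only: complex_norm_square[symmetric] integral_complex_of_real flip: of_real_power)

lemma L2_norm_0_AE: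
  assumes "f \<in> L2 M" "L2_norm M f = 0"
  shows "AE x in M. f x = 0"
proof -
  have "(LINT x|M. (cmod (f x))\<^sup>2) = 0"
    using assms(2) L2_norm_sq[of M f] by simp
  then show ?thesis
    using integral_nonneg_eq_0_iff_AE[OF L2_integrable_sq[OF assms(1)]] by simp
qed

text \<open>With \<open>N\<close> the squared norm of \<open>g\<close> and \<open>\<alpha>\<close>
  the inner product, expanding the squared norm of \<open>N f - \<alpha> g\<close> gives
  \<open>N\<close> times the difference of the two sides, squared. Scaling \<open>f\<close> by
  \<open>N\<close> avoids a quotient. If \<open>g\<close> has norm zero, it vanishes almost
  everywhere and both sides are zero.\<close>

lemma L2_Cauchy_Schwarz:
  assumes f: "f \<in> L2 M" and g: "g \<in> L2 M"
  shows "cmod (L2_inner M f g) \<le> L2_norm M f * L2_norm M g"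
proof (cases "L2_norm M g = 0")
  case True
  have "L2_inner M g f = L2_inner M (\<lambda>_. 0) f"
    by (intro L2_inner_cong_AE L2_norm_0_AE g L2_zero f True)
  then have "L2_inner M f g = 0"
    using L2_inner_cnj[of M g f] by (simp add: L2_inner_zero)
  then show ?thesis by (simp add: L2_norm_nonneg)
next
  case False
  define N where "N = (L2_norm M g)\<^sup>2"
  define \<alpha> where "\<alpha> = L2_inner M f g"
  define h where "h = (\<lambda>x. of_real N * f x + (- \<alpha>) * g x)"
  have N: "N > 0" using False by (simp add: N_def)
  have h: "h \<in> L2 M" unfolding h_def by (rule L2_lincomb[OF f g])
  have "L2_inner M h h = of_real N * L2_inner M f h + (- \<alpha>) * L2_inner M g h"
    using L2_inner_lincomb_left[OF f g h, of "of_real N" "- \<alpha>"] by (simp add: h_def)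
  also have "L2_inner M f h = of_real N * of_real ((L2_norm M f)\<^sup>2) - cnj \<alpha> * \<alpha>"
    unfolding h_def by (subst L2_inner_lincomb_right[OF f g f]) (simp add: L2_inner_self \<alpha>_def)
  also have "L2_inner M g h = of_real N * cnj \<alpha> - cnj \<alpha> * of_real N"
    unfolding h_def by (subst L2_inner_lincomb_right[OF f g g])
      (simp add: L2_inner_self \<alpha>_def N_def L2_inner_cnj)
  finally have "complex_of_real ((L2_norm M h)\<^sup>2)
      = of_real (N * (N * (L2_norm M f)\<^sup>2 - (cmod \<alpha>)\<^sup>2))"
    using complex_norm_square[of \<alpha>] by (simp add: L2_inner_self algebra_simps)
  then have "(L2_norm M h)\<^sup>2 = N * (N * (L2_norm M f)\<^sup>2 - (cmod \<alpha>)\<^sup>2)"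
    by (simp only: of_real_eq_iff)
  then have "0 \<le> N * (N * (L2_norm M f)\<^sup>2 - (cmod \<alpha>)\<^sup>2)"
    by (metis zero_le_power2)
  then have "(cmod \<alpha>)\<^sup>2 \<le> (L2_norm M f * L2_norm M g)\<^sup>2"
    using N by (simp add: zero_le_mult_iff power_mult_distrib N_def mult.commute)
  then show ?thesis
    unfolding \<alpha>_def by (rule power2_le_imp_le) (simp add: L2_norm_nonneg)
qed

text \<open>The squared norm of the combination \<open>h\<close> is expanded in the first slot only.
  Cauchy-Schwarz then leaves a factor \<open>L2_norm M h\<close> on both sides, which cancels unless
  it is zero.\<close>

lemma L2_norm_triangle:
  assumes f: "f \<in> L2 M" and g: "g \<in> L2 M"
  shows "L2_norm M (\<lambda>x. a * f x + b * g x) \<le> cmod a * L2_norm M f + cmod b * L2_norm M g"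
proof -
  define h where "h = (\<lambda>x. a * f x + b * g x)"
  have h: "h \<in> L2 M" unfolding h_def by (rule L2_lincomb[OF f g])
  have "(L2_norm M h)\<^sup>2 = cmod (L2_inner M h h)"
    unfolding L2_inner_self norm_of_real by simp
  also have "L2_inner M h h = a * L2_inner M f h + b * L2_inner M g h"
    using L2_inner_lincomb_left[OF f g h] by (simp add: h_def)
  also have "cmod \<dots> \<le> cmod a * cmod (L2_inner M f h) + cmod b * cmod (L2_inner M g h)"
    by (metis norm_mult norm_triangle_ineq)
  also have "\<dots> \<le> cmod a * (L2_norm M f * L2_norm M h) + cmod b * (L2_norm M g * L2_norm M h)"
    by (intro add_mono mult_left_mono L2_Cauchy_Schwarz f g h) simp_all
  finally have "L2_norm M h * L2_norm M h \<le> (cmod a * L2_norm M f + cmod b * L2_norm M g) * L2_norm M h"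
    by (simp add: power2_eq_square algebra_simps)
  then have "L2_norm M h \<le> cmod a * L2_norm M f + cmod b * L2_norm M g"
    using L2_norm_nonneg[of M] by (cases "L2_norm M h = 0")
      (auto simp: less_le intro!: add_nonneg_nonneg mult_nonneg_nonneg)
  then show ?thesis unfolding h_def .
qed

lemma L2_norm_scale:
  "L2_norm M (\<lambda>x. a * f x) = cmod a * L2_norm M f"
  by (simp add: L2_norm_def norm_mult power_mult_distrib real_sqrt_mult)

lemma L2_eq_AE_I:
  assumes f: "f \<in> L2 M" and g: "g \<in> L2 M"
    and eq: "\<And>h. h \<in> L2 M \<Longrightarrow> L2_inner M f h = L2_inner M g h"
  shows "AE x in M. f x = g x"
proof -
  define d where "d = (\<lambda>x. f x - g x)"
  have d: "d \<in> L2 M" unfolding d_def by (rule L2_diff[OF f g])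
  have "L2_inner M d d = L2_inner M f d - L2_inner M g d"
    using L2_inner_lincomb_left[OF f g d, of 1 "-1"] by (simp add: d_def)
  then have "L2_norm M d = 0"
    using eq[OF d] by (simp add: L2_inner_self)
  from L2_norm_0_AE[OF d this] show ?thesis
    by (simp add: d_def)
qed

section \<open>Linear maps modulo null sets\<close>

lemma linear_map_lincombD:
  assumes "linear_map M X N W T" "f \<in> X" "g \<in> X"
  shows "AE k in N. T (\<lambda>i. a * f i + b * g i) k = a * T f k + b * T g k"
  using assms unfolding linear_map_def by blast

lemma linear_map_memD:
  assumes "linear_map M X N W T" "f \<in> X"
  shows "T f \<in> W"
  using assms unfolding linear_map_def by blast

text \<open>\<open>T\<close> is linear only up to null sets, but inner products do not see null
  sets: after pairing with \<open>h\<close> the relation is an equation between numbers, ready for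
  rewriting.\<close>

lemma linear_map_inner_left:
  assumes T: "linear_map M X N (L2 N) T" and X: "csubspace_fun X"
    and fg: "f \<in> X" "g \<in> X" and h: "h \<in> L2 N"
  shows "L2_inner N (T (\<lambda>i. a * f i + b * g i)) h = a * L2_inner N (T f) h + b * L2_inner N (T g) h"
proof -
  have mem: "(\<lambda>i. a * f i + b * g i) \<in> X"
    using X fg unfolding csubspace_fun_def by blast
  have "L2_inner N (T (\<lambda>i. a * f i + b * g i)) h = L2_inner N (\<lambda>k. a * T f k + b * T g k) h"
    by (intro L2_inner_cong_AE linear_map_memD[OF T] mem h L2_lincomb fg
        linear_map_lincombD[OF T])
  then show ?thesis
    by (simp add: L2_inner_lincomb_left linear_map_memD[OF T] fg h)
qed

lemma bounded_linear_map_bound: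
  assumes "bounded_linear_map M X N T"
  obtains B where "0 \<le> B" "\<And>f. f \<in> X \<Longrightarrow> L2_norm N (T f) \<le> B * L2_norm M f"
proof -
  from assms obtain B where B: "\<And>f. f \<in> X \<Longrightarrow> L2_norm N (T f) \<le> B * L2_norm M f"
    unfolding bounded_linear_map_def by blast
  \<comment> \<open>The definition admits a negative constant; its positive part serves as well and
    can be used in monotonicity arguments and under a square root.\<close>
  have "L2_norm N (T f) \<le> max B 0 * L2_norm M f" if "f \<in> X" for f
    using B[OF that] mult_right_mono[OF max.cobounded1[of B 0] L2_norm_nonneg[of M f]] by linarith
  then show ?thesis by (intro that[of "max B 0"]) auto
qed

subsection \<open>The span of the power vectors\<close>

lemma csubspace_V_space: "csubspace_fun V_space"
  unfolding csubspace_fun_def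
proof (intro conjI ballI allI)
  show "(\<lambda>_. 0) \<in> V_space"
    unfolding V_space_def by (intro CollectI exI[of _ "{}"]) auto
  fix f g :: "nat \<Rightarrow> complex" and c d :: complex
  assume "f \<in> V_space" "g \<in> V_space"
  then obtain F a G b where F: "finite F" "F \<subseteq> ball 0 1" "f = (\<lambda>n. \<Sum>v\<in>F. a v * power_vec v n)"
    and G: "finite G" "G \<subseteq> ball 0 1" "g = (\<lambda>n. \<Sum>v\<in>G. b v * power_vec v n)"
    unfolding V_space_def by blast
  define e where "e v = c * (if v \<in> F then a v else 0) + d * (if v \<in> G then b v else 0)" for v
  have "(\<lambda>i. c * f i + d * g i) = (\<lambda>n. \<Sum>v\<in>F \<union> G. e v * power_vec v n)"
  proof
    fix n
    have "f n = (\<Sum>v\<in>F \<union> G. (if v \<in> F then a v else 0) * power_vec v n)"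
      unfolding F(3) using F(1) G(1) by (intro sum.mono_neutral_cong_left) auto
    moreover have "g n = (\<Sum>v\<in>F \<union> G. (if v \<in> G then b v else 0) * power_vec v n)"
      unfolding G(3) using F(1) G(1) by (intro sum.mono_neutral_cong_left) auto
    ultimately show "c * f n + d * g n = (\<Sum>v\<in>F \<union> G. e v * power_vec v n)"
      by (simp only: e_def sum_distrib_left distrib_right sum.distrib mult.assoc)
  qed
  then show "(\<lambda>i. c * f i + d * g i) \<in> V_space"
    unfolding V_space_def using F G by (intro CollectI exI[of _ "F \<union> G"] exI[of _ e]) auto
qed

lemma V_space_lincomb:
  "f \<in> V_space \<Longrightarrow> g \<in> V_space \<Longrightarrow> (\<lambda>i. a * f i + b * g i) \<in> V_space"
  using csubspace_V_space unfolding csubspace_fun_def by blast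

lemma power_vec_V_space: "z \<in> ball 0 1 \<Longrightarrow> power_vec z \<in> V_space"
  unfolding V_space_def by (intro CollectI exI[of _ "{z}"] exI[of _ "\<lambda>_. 1"]) auto

text \<open>Carries identities and existence claims that survive linear combinations from the power
  vectors to the whole span.\<close>

lemma V_space_induct [consumes 1, case_names power lincomb]:
  assumes v: "v \<in> V_space"
    and power: "\<And>z. z \<in> ball 0 1 \<Longrightarrow> P (power_vec z)"
    and lincomb: "\<And>f g a b. f \<in> V_space \<Longrightarrow> P f \<Longrightarrow> g \<in> V_space \<Longrightarrow> P g \<Longrightarrow>
      P (\<lambda>i. a * f i + b * g i)"
  shows "P v"
proof -
  obtain F a where F: "finite F" "F \<subseteq> ball 0 1" "v = (\<lambda>n. \<Sum>z\<in>F. a z * power_vec z n)"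
    using v unfolding V_space_def by blast
  have "(\<lambda>n. \<Sum>z\<in>F. a z * power_vec z n) \<in> V_space \<and> P (\<lambda>n. \<Sum>z\<in>F. a z * power_vec z n)"
    using F(1,2)
  proof (induction F rule: finite_induct)
    case empty
    \<comment> \<open>The rule has no zero case; the empty sum is the trivial combination of
      \<open>power_vec 0\<close> with itself.\<close>
    have 0: "power_vec 0 \<in> V_space" "P (power_vec 0)"
      by (simp_all add: power_vec_V_space power)
    have "P (\<lambda>i. 0 * power_vec 0 i + 0 * power_vec 0 i)"
      by (intro lincomb 0)
    then show ?case
      using csubspace_V_space by (simp add: csubspace_fun_def)
  next
    case (insert z F)
    let ?g = "\<lambda>n. \<Sum>z\<in>F. a z * power_vec z n"
    have z: "power_vec z \<in> V_space" "P (power_vec z)"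
      using insert.prems by (auto intro: power_vec_V_space power)
    have g: "?g \<in> V_space" "P ?g" using insert by auto
    have "(\<lambda>n. a z * power_vec z n + 1 * ?g n) \<in> V_space"
      by (rule V_space_lincomb[OF z(1) g(1)])
    moreover have "P (\<lambda>n. a z * power_vec z n + 1 * ?g n)"
      by (intro lincomb z g)
    ultimately show ?case using insert.hyps by simp
  qed
  then show ?thesis using F(3) by simp
qed

lemma V_space_ell2: "v \<in> V_space \<Longrightarrow> v \<in> ell2"
  by (induction rule: V_space_induct) (auto intro: power_vec_ell2 ell2_lincomb)

subsection \<open>Density of the span in \<open>\<ell>\<^sup>2\<close>\<close>

text \<open>The aim is to place the unit vectors in this set: that is the form of density used to
  separate vectors and to construct coordinates.\<close>

definition V_closure :: "(nat \<Rightarrow> complex) set" where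
  "V_closure = {x \<in> ell2. \<forall>\<epsilon>>0. \<exists>v\<in>V_space. L2_norm cnt (\<lambda>i. v i - x i) < \<epsilon>}"

lemma V_closure_ell2: "x \<in> V_closure \<Longrightarrow> x \<in> ell2"
  by (simp add: V_closure_def)

lemma V_closureD:
  assumes "x \<in> V_closure" "\<epsilon> > 0"
  obtains v where "v \<in> V_space" "L2_norm cnt (\<lambda>i. v i - x i) < \<epsilon>"
  using assms unfolding V_closure_def by blast

lemma V_space_subset_closure: "v \<in> V_space \<Longrightarrow> v \<in> V_closure"
  unfolding V_closure_def using V_space_ell2 by (force simp: L2_norm_def)

lemma V_closure_lincomb:
  assumes x: "x \<in> V_closure" and y: "y \<in> V_closure"
  shows "(\<lambda>i. a * x i + b * y i) \<in> V_closure"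
  unfolding V_closure_def
proof (intro CollectI conjI allI impI)
  show "(\<lambda>i. a * x i + b * y i) \<in> ell2"
    by (intro L2_lincomb V_closure_ell2 x y)
  fix \<epsilon> :: real assume "\<epsilon> > 0"
  \<comment> \<open>The summand 1 keeps the denominator positive when \<open>a = b = 0\<close> and
    makes the final estimate strict.\<close>
  define \<delta> where "\<delta> = \<epsilon> / (cmod a + cmod b + 1)"
  have pos: "cmod a + cmod b + 1 > 0" by (intro add_nonneg_pos add_nonneg_nonneg) auto
  have \<delta>: "\<delta> > 0" using pos \<open>\<epsilon> > 0\<close> by (simp add: \<delta>_def)
  obtain u where u: "u \<in> V_space" "L2_norm cnt (\<lambda>i. u i - x i) < \<delta>"
    using V_closureD[OF x \<delta>] .
  obtain v where v: "v \<in> V_space" "L2_norm cnt (\<lambda>i. v i - y i) < \<delta>"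
    using V_closureD[OF y \<delta>] .
  have "L2_norm cnt (\<lambda>i. (a * u i + b * v i) - (a * x i + b * y i))
      = L2_norm cnt (\<lambda>i. a * (u i - x i) + b * (v i - y i))"
    by (simp add: algebra_simps)
  also have "\<dots> \<le> cmod a * L2_norm cnt (\<lambda>i. u i - x i) + cmod b * L2_norm cnt (\<lambda>i. v i - y i)"
    by (intro L2_norm_triangle L2_diff V_space_ell2 u v V_closure_ell2 x y)
  also have "\<dots> \<le> cmod a * \<delta> + cmod b * \<delta>"
    using u v by (intro add_mono mult_left_mono) auto
  also have "\<dots> < (cmod a + cmod b + 1) * \<delta>"
    using \<delta> by (simp add: algebra_simps)
  also have "\<dots> = \<epsilon>" using pos by (simp add: \<delta>_def)
  finally show "\<exists>v\<in>V_space. L2_norm cnt (\<lambda>i. v i - (a * x i + b * y i)) < \<epsilon>"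
    by (intro bexI[of _ "\<lambda>i. a * u i + b * v i"] V_space_lincomb u v)
qed

lemma V_closure_closed:
  assumes x: "x \<in> ell2"
    and approx: "\<And>\<epsilon>. \<epsilon> > 0 \<Longrightarrow> \<exists>y\<in>V_closure. L2_norm cnt (\<lambda>i. y i - x i) < \<epsilon>"
  shows "x \<in> V_closure"
  unfolding V_closure_def
proof (intro CollectI conjI allI impI)
  fix \<epsilon> :: real assume "\<epsilon> > 0"
  then have \<epsilon>: "\<epsilon> / 2 > 0" by simp
  obtain y where y: "y \<in> V_closure" "L2_norm cnt (\<lambda>i. y i - x i) < \<epsilon> / 2"
    using approx[OF \<epsilon>] by blast
  obtain v where v: "v \<in> V_space" "L2_norm cnt (\<lambda>i. v i - y i) < \<epsilon> / 2"
    using V_closureD[OF y(1) \<epsilon>] .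
  have "L2_norm cnt (\<lambda>i. 1 * (v i - y i) + 1 * (y i - x i))
      \<le> cmod 1 * L2_norm cnt (\<lambda>i. v i - y i) + cmod 1 * L2_norm cnt (\<lambda>i. y i - x i)"
    by (intro L2_norm_triangle L2_diff V_space_ell2 v V_closure_ell2 x y)
  with v y have "L2_norm cnt (\<lambda>i. v i - x i) < \<epsilon>" by simp
  then show "\<exists>v\<in>V_space. L2_norm cnt (\<lambda>i. v i - x i) < \<epsilon>"
    using v(1) by blast
qed (fact x)

definition shifted_power_vec :: "nat \<Rightarrow> complex \<Rightarrow> nat \<Rightarrow> complex" where
  "shifted_power_vec k z n = (if n < k then 0 else z ^ (n - k))"

text \<open>The unilateral shift is an isometry: it only inserts \<open>k\<close> zero terms into
  the series of squares.\<close>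

lemma shifted_power_vec_ell2:
  assumes "z \<in> ball 0 1"
  shows "shifted_power_vec k z \<in> ell2"
    and "L2_norm cnt (shifted_power_vec k z) = L2_norm cnt (power_vec z)"
proof -
  have "(\<lambda>n. (cmod (power_vec z n))\<^sup>2) sums (\<Sum>n. (cmod (power_vec z n))\<^sup>2)"
    using power_vec_ell2[OF assms] by (simp add: ell2_iff summable_sums)
  then have "(\<lambda>n. (cmod (shifted_power_vec k z (n + k)))\<^sup>2) sums (\<Sum>n. (cmod (power_vec z n))\<^sup>2)"
    by (simp add: shifted_power_vec_def power_vec_def)
  then have s: "(\<lambda>n. (cmod (shifted_power_vec k z n))\<^sup>2) sums (\<Sum>n. (cmod (power_vec z n))\<^sup>2)"
    by (subst (asm) sums_iff_shift) (simp add: shifted_power_vec_def)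
  then show mem: "shifted_power_vec k z \<in> ell2"
    by (simp add: ell2_iff sums_summable)
  show "L2_norm cnt (shifted_power_vec k z) = L2_norm cnt (power_vec z)"
    using s by (simp add: ell2_norm_eq[OF mem] ell2_norm_eq[OF power_vec_ell2[OF assms]] sums_iff)
qed

lemma shifted_power_vec_rec:
  "shifted_power_vec k z n - unit_vec k n = z * shifted_power_vec (Suc k) z n"
  by (cases "n \<le> k") (auto simp: shifted_power_vec_def unit_vec_def Suc_diff_Suc simp flip: power_Suc)

text \<open>Comparison with the geometric series of ratio 1/2. The bound is uniform near 0, so
  \<open>z\<close> times a shifted power vector tends to 0 with \<open>z\<close>.\<close>

lemma power_vec_norm_le:
  assumes "cmod z \<le> 1 / 2"
  shows "L2_norm cnt (power_vec z) \<le> 2"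
proof -
  have b: "z \<in> ball 0 1" using assms by simp
  have s: "summable (\<lambda>n. (cmod (power_vec z n))\<^sup>2)"
    using power_vec_ell2[OF b] by (simp add: ell2_iff)
  have "(\<Sum>n. (cmod (power_vec z n))\<^sup>2) \<le> (\<Sum>n. (1/2) ^ n)"
  proof (rule suminf_le[OF _ s])
    show "(cmod (power_vec z n))\<^sup>2 \<le> (1/2) ^ n" for n
    proof -
      have "(cmod (power_vec z n))\<^sup>2 = cmod z ^ n * cmod z ^ n"
        by (simp add: power_vec_def norm_power power2_eq_square)
      also have "\<dots> \<le> (1/2) ^ n * 1"
        using assms by (intro mult_mono power_mono power_le_one) auto
      finally show ?thesis by simp
    qed
  qed (simp add: summable_geometric)
  also have "\<dots> = 2" by (subst suminf_geometric) auto
  finally have "L2_norm cnt (power_vec z) \<le> sqrt 2"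
    by (simp add: ell2_norm_eq[OF power_vec_ell2[OF b]])
  also have "\<dots> \<le> 2" by (rule real_le_lsqrt) auto
  finally show ?thesis .
qed

text \<open>
  The vectors \<open>p\<^sub>k(z) = (0, \<dots>, 0, 1, z, z\<^sup>2, \<dots>)\<close> satisfy \<open>p\<^sub>k(z) - e\<^sub>k = z p\<^sub>k\<^sub>+\<^sub>1(z)\<close>, so that
  \<open>e\<^sub>k = lim p\<^sub>k(z)\<close> as \<open>z \<rightarrow> 0\<close>; both families are moved into the closure by induction on \<open>k\<close>.
\<close>

lemma unit_vec_V_closure: "unit_vec k \<in> V_closure"
proof -
  have lim: "unit_vec k \<in> V_closure"
    if p: "\<And>z. z \<in> ball 0 1 - {0} \<Longrightarrow> shifted_power_vec k z \<in> V_closure" for k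
  proof (rule V_closure_closed[OF unit_vec_ell2])
    fix \<epsilon> :: real assume "\<epsilon> > 0"
    \<comment> \<open>The bound 1/2 makes \<open>power_vec_norm_le\<close> applicable, and
      \<open>\<epsilon> / 4\<close> makes the error, at most \<open>2 * t\<close>, smaller than
      \<open>\<epsilon>\<close>.\<close>
    define t where "t = min (1/2) (\<epsilon> / 4)"
    define z where "z = complex_of_real t"
    have t: "0 < t" "t \<le> 1/2" "t \<le> \<epsilon> / 4" using \<open>\<epsilon> > 0\<close> by (auto simp: t_def)
    then have z: "z \<in> ball 0 1" "z \<noteq> 0" "cmod z \<le> 1 / 2" "cmod z = t"
      by (auto simp: z_def)
    have "L2_norm cnt (\<lambda>n. shifted_power_vec k z n - unit_vec k n) = t * L2_norm cnt (power_vec z)"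
      unfolding shifted_power_vec_rec
      by (simp add: L2_norm_scale shifted_power_vec_ell2(2)[OF z(1)] z(4))
    also have "\<dots> \<le> t * 2"
      using power_vec_norm_le[OF z(3)] t by (intro mult_left_mono) auto
    also have "\<dots> < \<epsilon>" using t \<open>\<epsilon> > 0\<close> by linarith
    finally show "\<exists>y\<in>V_closure. L2_norm cnt (\<lambda>i. y i - unit_vec k i) < \<epsilon>"
      using p z by blast
  qed
  have "shifted_power_vec k z \<in> V_closure" if z: "z \<in> ball 0 1 - {0}" for z
    using z
  proof (induction k arbitrary: z)
    case 0
    have "shifted_power_vec 0 z = power_vec z"
      by (simp add: shifted_power_vec_def power_vec_def fun_eq_iff)
    with 0 show ?case
      by (simp add: V_space_subset_closure power_vec_V_space)
  next
    case (Suc k)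
    have "(\<lambda>n. inverse z * shifted_power_vec k z n + (- inverse z) * unit_vec k n) \<in> V_closure"
      by (intro V_closure_lincomb Suc lim)
    also have "(\<lambda>n. inverse z * shifted_power_vec k z n + (- inverse z) * unit_vec k n)
        = shifted_power_vec (Suc k) z"
    proof
      fix n
      have "inverse z * shifted_power_vec k z n + (- inverse z) * unit_vec k n
          = inverse z * (shifted_power_vec k z n - unit_vec k n)"
        by (simp add: algebra_simps)
      also have "\<dots> = shifted_power_vec (Suc k) z n"
        unfolding shifted_power_vec_rec using Suc.prems by simp
      finally show "inverse z * shifted_power_vec k z n + (- inverse z) * unit_vec k n
        = shifted_power_vec (Suc k) z n" .
    qed
    finally show ?case .
  qed
  then show ?thesis by (rule lim)
qed

text \<open>The difference \<open>d\<close> is orthogonal to the span, so its product with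
  \<open>v - unit_vec k\<close> is \<open>- d k\<close> for every \<open>v\<close> in the span.
  Choosing \<open>v\<close> close to \<open>unit_vec k\<close> makes this arbitrarily small.\<close>

lemma V_space_inner_eqD:
  assumes x: "x \<in> ell2" and y: "y \<in> ell2"
    and eq: "\<And>v. v \<in> V_space \<Longrightarrow> ell2_inner x v = ell2_inner y v"
  shows "x = y"
proof
  fix k
  define d where "d = (\<lambda>i. x i - y i)"
  have d: "d \<in> ell2" unfolding d_def by (rule L2_diff[OF x y])
  have dv: "ell2_inner d v = 0" if "v \<in> V_space" for v
    using L2_inner_lincomb_left[OF x y V_space_ell2[OF that], of 1 "-1"] eq[OF that]
    by (simp add: d_def)
  have "cmod (d k) \<le> 0 + \<epsilon>" if \<epsilon>: "\<epsilon> > 0" for \<epsilon>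
  proof -
    \<comment> \<open>The summand 1 permits division by \<open>N\<close> even when \<open>d\<close>
      has norm zero.\<close>
    define N where "N = L2_norm cnt d + 1"
    have N: "N > 0" using L2_norm_nonneg[of cnt d] by (simp add: N_def)
    obtain v where v: "v \<in> V_space" "L2_norm cnt (\<lambda>i. v i - unit_vec k i) < \<epsilon> / N"
      using V_closureD[OF unit_vec_V_closure divide_pos_pos[OF \<epsilon> N]] .
    have v2: "v \<in> ell2" by (rule V_space_ell2[OF v(1)])
    have "ell2_inner d (\<lambda>i. v i - unit_vec k i) = - d k"
      using L2_inner_lincomb_right[OF v2 unit_vec_ell2 d, of 1 "-1" k] dv[OF v(1)]
        ell2_coord_eq_inner[OF d, of k] by simp
    then have "cmod (d k) \<le> L2_norm cnt d * L2_norm cnt (\<lambda>i. v i - unit_vec k i)"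
      using L2_Cauchy_Schwarz[OF d L2_diff[OF v2 unit_vec_ell2], of k] by simp
    also have "\<dots> \<le> N * (\<epsilon> / N)"
      using v(2) N L2_norm_nonneg by (intro mult_mono) (auto simp: N_def less_imp_le)
    finally show ?thesis using N by simp
  qed
  then have "cmod (d k) \<le> 0" by (rule field_le_epsilon)
  then show "x k = y k" by (simp add: d_def)
qed

text \<open>The norm of the part cut off is the square root of a tail of a convergent
  series.\<close>

lemma ell2_approx:
  assumes x: "x \<in> ell2" and "\<epsilon> > 0"
  obtains N0 where "\<And>N. N \<ge> N0 \<Longrightarrow> L2_norm cnt (\<lambda>i. x i - (if i < N then x i else 0)) < \<epsilon>"
proof -
  define f where "f n = (cmod (x n))\<^sup>2" for n
  have sf: "summable f" using x by (simp add: ell2_iff f_def[abs_def])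
  have norm: "L2_norm cnt (\<lambda>i. x i - (if i < N then x i else 0)) = sqrt (suminf f - sum f {..<N})" for N
  proof -
    have s: "(\<lambda>n. f n - (if n < N then f n else 0)) sums (suminf f - sum f {..<N})"
      using sums_If_finite_set[of "{..<N}" f] sf
      by (intro sums_diff summable_sums) simp_all
    have eq: "(\<lambda>n. (cmod (x n - (if n < N then x n else 0)))\<^sup>2) = (\<lambda>n. f n - (if n < N then f n else 0))"
      by (rule ext) (simp add: f_def)
    have "(\<lambda>i. x i - (if i < N then x i else 0)) \<in> ell2"
      unfolding ell2_iff eq using s by (rule sums_summable)
    from ell2_norm_eq[OF this] show ?thesis
      unfolding eq using s by (simp add: sums_iff)
  qed
  have "(\<lambda>N. sqrt (suminf f - sum f {..<N})) \<longlonglongrightarrow> sqrt (suminf f - suminf f)"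
    by (rule tendsto_real_sqrt[OF tendsto_diff[OF tendsto_const summable_LIMSEQ[OF sf]]])
  then have "eventually (\<lambda>N. sqrt (suminf f - sum f {..<N}) < \<epsilon>) sequentially"
    by (rule order_tendstoD(2)) (simp add: assms)
  then show ?thesis
    using that by (auto simp: eventually_sequentially norm)
qed

subsection \<open>Operators on \<open>\<ell>\<^sup>2\<close>\<close>

text \<open>Riesz representation for a functional given on the span only. The coordinates of the
  representing vector ought to be values at unit vectors, which need not lie in the span; they are
  found as limits \<open>\<beta> k\<close> of \<open>\<phi>\<close> along approximants
  \<open>u k j\<close> of \<open>unit_vec k\<close>.\<close>

lemma V_space_Riesz:
  fixes \<phi> :: "(nat \<Rightarrow> complex) \<Rightarrow> complex"
  assumes lin: "\<And>f g a b. f \<in> V_space \<Longrightarrow> g \<in> V_space \<Longrightarrow>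
      \<phi> (\<lambda>i. a * f i + b * g i) = a * \<phi> f + b * \<phi> g"
    and bd: "\<And>f. f \<in> V_space \<Longrightarrow> cmod (\<phi> f) \<le> M * L2_norm cnt f" and M: "0 \<le> M"
  obtains b where "b \<in> ell2" "L2_norm cnt b \<le> M" "\<And>v. v \<in> V_space \<Longrightarrow> ell2_inner v b = \<phi> v"
proof -
  have "\<exists>v\<in>V_space. L2_norm cnt (\<lambda>i. v i - unit_vec k i) < 1 / real (Suc j)" for k j
    by (rule V_closureD[OF unit_vec_V_closure[of k], of "1 / real (Suc j)"]) auto
  then obtain u where u: "\<And>k j. u k j \<in> V_space"
    and ue: "\<And>k j. L2_norm cnt (\<lambda>i. u k j i - unit_vec k i) < 1 / real (Suc j)"
    by metis
  have u2: "u k j \<in> ell2" for k j by (rule V_space_ell2[OF u])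
  have null: "(\<lambda>j. 1 / real (Suc j)) \<longlonglongrightarrow> 0"
    by (rule LIMSEQ_Suc[OF lim_1_over_n])
  have diff: "cmod (\<phi> (u k i) - \<phi> (u k j)) \<le> M * (1 / real (Suc i) + 1 / real (Suc j))" for k i j
  proof -
    have "cmod (\<phi> (u k i) - \<phi> (u k j)) \<le> M * L2_norm cnt (\<lambda>n. 1 * u k i n + (-1) * u k j n)"
      using bd[OF V_space_lincomb[OF u u], of 1 k i "-1" k j] lin[OF u u, of 1 k i "-1" k j]
      by simp
    also have "(\<lambda>n. 1 * u k i n + (-1) * u k j n)
        = (\<lambda>n. 1 * (u k i n - unit_vec k n) + (-1) * (u k j n - unit_vec k n))"
      by auto
    also have "L2_norm cnt \<dots> \<le> cmod 1 * L2_norm cnt (\<lambda>n. u k i n - unit_vec k n)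
        + cmod (-1) * L2_norm cnt (\<lambda>n. u k j n - unit_vec k n)"
      by (intro L2_norm_triangle L2_diff u2 unit_vec_ell2)
    also have "\<dots> \<le> 1 / real (Suc i) + 1 / real (Suc j)"
      using ue[of k i] ue[of k j] by simp
    finally show ?thesis using M by (simp add: mult_left_mono)
  qed
  have "Cauchy (\<lambda>j. \<phi> (u k j))" for k
  proof (rule metric_CauchyI)
    fix \<epsilon> :: real assume "\<epsilon> > 0"
    \<comment> \<open>\<open>M + 1\<close> stands in for \<open>M\<close> to cover
      \<open>M = 0\<close>; the 2 accounts for the two error terms in \<open>diff\<close>.\<close>
    then have e: "\<epsilon> / (2 * (M + 1)) > 0" using M by simp
    have "eventually (\<lambda>j. 1 / real (Suc j) < \<epsilon> / (2 * (M + 1))) sequentially"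
      by (rule order_tendstoD(2)[OF null e])
    then obtain J where J: "\<And>j. j \<ge> J \<Longrightarrow> 1 / real (Suc j) < \<epsilon> / (2 * (M + 1))"
      by (auto simp: eventually_sequentially)
    have half: "N * (\<epsilon> / (2 * N) + \<epsilon> / (2 * N)) = \<epsilon>" if "N \<noteq> 0" for N :: real
      using that by (simp add: field_simps)
    have "dist (\<phi> (u k i)) (\<phi> (u k j)) < \<epsilon>" if "i \<ge> J" "j \<ge> J" for i j
    proof -
      have "cmod (\<phi> (u k i) - \<phi> (u k j)) \<le> (M + 1) * (1 / real (Suc i) + 1 / real (Suc j))"
        by (rule order_trans[OF diff]) (intro mult_right_mono, auto)
      also have "\<dots> < (M + 1) * (\<epsilon> / (2 * (M + 1)) + \<epsilon> / (2 * (M + 1)))"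
        using M J[OF that(1)] J[OF that(2)] by (intro mult_strict_left_mono add_strict_mono) auto
      also have "\<dots> = \<epsilon>" using half[of "M + 1"] M by simp
      finally show ?thesis by (simp add: dist_norm)
    qed
    then show "\<exists>J. \<forall>i\<ge>J. \<forall>j\<ge>J. dist (\<phi> (u k i)) (\<phi> (u k j)) < \<epsilon>" by blast
  qed
  then have "\<exists>l. (\<lambda>j. \<phi> (u k j)) \<longlonglongrightarrow> l" for k
    by (simp add: Cauchy_convergent_iff convergent_def)
  then obtain \<beta> where \<beta>: "\<And>k. (\<lambda>j. \<phi> (u k j)) \<longlonglongrightarrow> \<beta> k"
    by metis
  define t where "t N x i = (if i < N then x i else (0::complex))" for N x and i :: nat
  have t2: "t N x \<in> ell2" for N x
    unfolding ell2_iff by (rule summable_finite[of "{..<N}"]) (auto simp: t_def)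
  \<comment> \<open>The sum stands for the value of \<open>\<phi>\<close> at the truncation
    \<open>t N x\<close>, which need not lie in the span. In the induction, with \<open>v\<close>
    arbitrary, \<open>x N\<close> times \<open>u N j\<close> is subtracted from \<open>v\<close> to
    remove the last coordinate up to a small error, and then \<open>j\<close> tends to
    infinity.\<close>
  have key: "cmod (\<phi> v - (\<Sum>k<N. x k * \<beta> k)) \<le> M * L2_norm cnt (\<lambda>i. v i - t N x i)"
    if "v \<in> V_space" for v N x
    using that
  proof (induction N arbitrary: v)
    case 0
    then show ?case using bd[OF 0] by (simp add: t_def)
  next
    case (Suc N)
    have v2: "v \<in> ell2" by (rule V_space_ell2[OF Suc.prems])
    have step: "cmod (\<phi> v - x N * \<phi> (u N j) - (\<Sum>k<N. x k * \<beta> k))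
        \<le> M * (L2_norm cnt (\<lambda>i. v i - t (Suc N) x i) + cmod (x N) * (1 / real (Suc j)))" for j
    proof -
      let ?v = "\<lambda>i. 1 * v i + (- x N) * u N j i"
      have "L2_norm cnt (\<lambda>i. ?v i - t N x i)
          = L2_norm cnt (\<lambda>i. 1 * (v i - t (Suc N) x i) + (- x N) * (u N j i - unit_vec N i))"
        by (rule arg_cong[where f = "L2_norm cnt"])
          (auto simp: t_def unit_vec_def less_Suc_eq algebra_simps)
      also have "\<dots> \<le> cmod 1 * L2_norm cnt (\<lambda>i. v i - t (Suc N) x i)
          + cmod (- x N) * L2_norm cnt (\<lambda>i. u N j i - unit_vec N i)"
        by (intro L2_norm_triangle L2_diff v2 t2 u2 unit_vec_ell2)
      also have "\<dots> \<le> L2_norm cnt (\<lambda>i. v i - t (Suc N) x i) + cmod (x N) * (1 / real (Suc j))"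
        unfolding norm_minus_cancel norm_one mult_1
        by (intro add_left_mono mult_left_mono less_imp_le[OF ue]) auto
      finally have "M * L2_norm cnt (\<lambda>i. ?v i - t N x i)
          \<le> M * (L2_norm cnt (\<lambda>i. v i - t (Suc N) x i) + cmod (x N) * (1 / real (Suc j)))"
        using M by (rule mult_left_mono)
      moreover have "cmod (\<phi> ?v - (\<Sum>k<N. x k * \<beta> k)) \<le> M * L2_norm cnt (\<lambda>i. ?v i - t N x i)"
        by (intro Suc.IH V_space_lincomb Suc.prems u)
      moreover have "\<phi> ?v = \<phi> v - x N * \<phi> (u N j)"
        using lin[OF Suc.prems u, of 1 "- x N"] by simp
      ultimately show ?thesis by simp
    qed
    have "(\<lambda>j. cmod (\<phi> v - x N * \<phi> (u N j) - (\<Sum>k<N. x k * \<beta> k)))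
        \<longlonglongrightarrow> cmod (\<phi> v - x N * \<beta> N - (\<Sum>k<N. x k * \<beta> k))"
      by (intro tendsto_intros \<beta>)
    moreover have "(\<lambda>j. M * (L2_norm cnt (\<lambda>i. v i - t (Suc N) x i) + cmod (x N) * (1 / real (Suc j))))
        \<longlonglongrightarrow> M * (L2_norm cnt (\<lambda>i. v i - t (Suc N) x i) + cmod (x N) * 0)"
      by (intro tendsto_intros null)
    ultimately have "cmod (\<phi> v - x N * \<beta> N - (\<Sum>k<N. x k * \<beta> k))
        \<le> M * (L2_norm cnt (\<lambda>i. v i - t (Suc N) x i) + cmod (x N) * 0)"
      by (rule LIMSEQ_le) (use step in blast)
    then show ?case by (simp add: algebra_simps)
  qed
  \<comment> \<open>Conjugated because the inner product is conjugate linear in its second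
    argument.\<close>
  define b where "b k = cnj (\<beta> k)" for k
  \<comment> \<open>This is \<open>key\<close> at the zero vector with coefficients
    \<open>b\<close>: the sum is \<open>S\<close>, the truncation has norm \<open>sqrt S\<close>,
    and \<open>S \<le> M * sqrt S\<close> yields the bound.\<close>
  have partial: "(\<Sum>k<N. (cmod (b k))\<^sup>2) \<le> M\<^sup>2" for N
  proof -
    define S where "S = (\<Sum>k<N. (cmod (b k))\<^sup>2)"
    have S0: "S \<ge> 0" unfolding S_def by (intro sum_nonneg) auto
    have zero: "(\<lambda>_. 0) \<in> V_space"
      using csubspace_V_space by (simp add: csubspace_fun_def)
    have "\<phi> (\<lambda>_. 0) = 0"
      using lin[OF zero zero, of 0 0] by simp
    then have "cmod (\<Sum>k<N. b k * \<beta> k) \<le> M * L2_norm cnt (\<lambda>i. - t N b i)"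
      using key[OF zero, of b N] by simp
    also have "(\<Sum>k<N. b k * \<beta> k) = of_real S"
      unfolding S_def of_real_sum complex_norm_square by (simp add: b_def)
    also have "L2_norm cnt (\<lambda>i. - t N b i) = L2_norm cnt (t N b)"
      by (simp add: L2_norm_def)
    also have "L2_norm cnt (t N b) = sqrt S"
    proof -
      have "(\<lambda>n. (cmod (t N b n))\<^sup>2) sums (\<Sum>n\<in>{..<N}. (cmod (t N b n))\<^sup>2)"
        by (rule sums_finite) (auto simp: t_def)
      then show ?thesis by (simp add: ell2_norm_eq[OF t2] sums_iff S_def t_def)
    qed
    finally have "sqrt S * sqrt S \<le> M * sqrt S" using S0 by simp
    then have "sqrt S \<le> M"
      using M S0 mult_le_cancel_right_pos[of "sqrt S" "sqrt S" M] by (cases "S = 0") auto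
    then show ?thesis unfolding S_def[symmetric] by (rule sqrt_le_D)
  qed
  have sb: "summable (\<lambda>k. (cmod (b k))\<^sup>2)"
    by (rule summableI_nonneg_bounded[where x = "M\<^sup>2"]) (auto simp: partial)
  then have b2: "b \<in> ell2" by (simp add: ell2_iff)
  have "(\<Sum>k. (cmod (b k))\<^sup>2) \<le> M\<^sup>2"
    by (rule suminf_le_const[OF sb partial])
  then have "L2_norm cnt b \<le> M"
    unfolding ell2_norm_eq[OF b2] using M by (intro real_le_lsqrt) auto
  moreover have "ell2_inner v b = \<phi> v" if v: "v \<in> V_space" for v
  proof -
    have v2: "v \<in> ell2" by (rule V_space_ell2[OF v])
    \<comment> \<open>Now \<open>key\<close> with the coordinates of \<open>v\<close> itself: the
      error is \<open>M\<close> times the norm of a tail of \<open>v\<close>.\<close>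
    have "(\<lambda>N. \<Sum>k<N. v k * \<beta> k) \<longlonglongrightarrow> \<phi> v"
    proof (rule LIMSEQ_I)
      fix \<epsilon> :: real assume "\<epsilon> > 0"
      then have e: "\<epsilon> / (M + 1) > 0" using M by simp
      obtain N0 where N0: "\<And>N. N \<ge> N0 \<Longrightarrow> L2_norm cnt (\<lambda>i. v i - (if i < N then v i else 0)) < \<epsilon> / (M + 1)"
        using ell2_approx[OF v2 e] by blast
      have "norm ((\<Sum>k<N. v k * \<beta> k) - \<phi> v) < \<epsilon>" if "N \<ge> N0" for N
      proof -
        let ?L = "L2_norm cnt (\<lambda>i. v i - t N v i)"
        have "norm ((\<Sum>k<N. v k * \<beta> k) - \<phi> v) \<le> M * ?L"
          using key[OF v, of v N] by (simp add: norm_minus_commute)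
        also have "\<dots> \<le> (M + 1) * ?L"
          by (intro mult_right_mono L2_norm_nonneg) auto
        also have "\<dots> < (M + 1) * (\<epsilon> / (M + 1))"
          using N0[OF that] M by (intro mult_strict_left_mono) (auto simp: t_def)
        finally show ?thesis using M by simp
      qed
      then show "\<exists>N0. \<forall>N\<ge>N0. norm ((\<Sum>k<N. v k * \<beta> k) - \<phi> v) < \<epsilon>" by blast
    qed
    then have "(\<lambda>k. v k * cnj (b k)) sums \<phi> v"
      by (simp add: sums_def b_def)
    then show ?thesis by (simp add: ell2_inner_eq[OF v2 b2] sums_iff)
  qed
  ultimately show ?thesis using that b2 by blast
qed

text \<open>Polarization: the quadratic form is real at \<open>x + c y\<close> for every scalar
  \<open>c\<close>, so the imaginary part of the two cross terms together vanishes.\<close>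

lemma positive_op_selfadjoint:
  assumes C: "bounded_op_ell2 C" and pos: "positive_op_ell2 C" and x: "x \<in> ell2" and y: "y \<in> ell2"
  shows "ell2_inner (C x) y = ell2_inner x (C y)"
proof -
  have Cx: "C x \<in> ell2" and Cy: "C y \<in> ell2" using ell2_op_mem[OF C] x y by auto
  have real: "Im (ell2_inner (C z) z) = 0" if "z \<in> ell2" for z
  proof -
    have "ell2_inner (C z) z \<in> \<real>\<^sub>\<ge>\<^sub>0"
      using pos that unfolding positive_op_ell2_def by blast
    then show ?thesis by (auto simp: complex_nonneg_Reals_iff)
  qed
  have expand: "ell2_inner (C (\<lambda>i. 1 * x i + c * y i)) (\<lambda>i. 1 * x i + c * y i)
      = ell2_inner (C x) x + cnj c * ell2_inner (C x) y
        + c * (ell2_inner (C y) x + cnj c * ell2_inner (C y) y)" for c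
  proof -
    have "C (\<lambda>i. 1 * x i + c * y i) = (\<lambda>i. 1 * C x i + c * C y i)"
      by (rule ext) (rule ell2_op_lincomb[OF C x y])
    then show ?thesis
      by (simp only: L2_inner_lincomb_left[OF Cx Cy L2_lincomb[OF x y]]
          L2_inner_lincomb_right[OF x y Cx] L2_inner_lincomb_right[OF x y Cy]) simp
  qed
  have im: "Im (cnj c * ell2_inner (C x) y + c * ell2_inner (C y) x) = 0" for c
    using real[OF L2_lincomb[OF x y, of 1 c]] real[OF x] real[OF y]
    unfolding expand by (simp add: algebra_simps)
  \<comment> \<open>\<open>c = 1\<close> compares the imaginary parts and \<open>c = \<i>\<close>
    the real parts.\<close>
  have "ell2_inner (C x) y = cnj (ell2_inner (C y) x)"
    using im[of 1] im[of \<i>] by (simp add: complex_eq_iff)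
  then show ?thesis by (simp add: L2_inner_cnj)
qed

subsection \<open>Synthesis and analysis\<close>

text \<open>The entries are bounded by the sum \<open>B\<close> of the moduli, so the squares are
  dominated by \<open>B\<close> times the moduli.\<close>

lemma ell1_ell2: "c \<in> ell1 \<Longrightarrow> c \<in> ell2"
proof -
  assume "c \<in> ell1"
  then have s: "summable (\<lambda>n. cmod (c n))" by (simp add: ell1_def)
  define B where "B = (\<Sum>n. cmod (c n))"
  have "cmod (c n) \<le> B" for n
    using sum_le_suminf[OF s, of "{n}"] by (simp add: B_def)
  then have "(cmod (c n))\<^sup>2 \<le> B * cmod (c n)" for n
    by (simp add: power2_eq_square mult_right_mono)
  then show "c \<in> ell2"
    unfolding ell2_iff
    by - (rule summable_comparison_test'[OF summable_mult[OF s, of B], where N = 0], simp)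
qed

lemma ell2_ell_inf: "x \<in> ell2 \<Longrightarrow> x \<in> ell_inf"
  unfolding ell_inf_def
proof (intro CollectI boundedI)
  fix y assume x: "x \<in> ell2" and "y \<in> range x"
  then obtain n where y: "y = x n" by auto
  have "(\<Sum>k\<in>{n}. (cmod (x k))\<^sup>2) \<le> (\<Sum>k. (cmod (x k))\<^sup>2)"
    using x by (intro sum_le_suminf) (auto simp: ell2_iff)
  then show "norm y \<le> sqrt (\<Sum>k. (cmod (x k))\<^sup>2)"
    by (simp add: y real_le_rsqrt)
qed

lemma csubspace_ell1: "csubspace_fun ell1"
  unfolding csubspace_fun_def
proof (intro conjI ballI allI)
  fix f g :: "nat \<Rightarrow> complex" and a b
  assume "f \<in> ell1" "g \<in> ell1"
  then have "summable (\<lambda>n. cmod a * cmod (f n) + cmod b * cmod (g n))"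
    by (intro summable_add summable_mult) (simp_all add: ell1_def)
  moreover have "cmod (a * f n + b * g n) \<le> cmod a * cmod (f n) + cmod b * cmod (g n)" for n
    by (metis norm_mult norm_triangle_ineq)
  ultimately show "(\<lambda>i. a * f i + b * g i) \<in> ell1"
    unfolding ell1_def
    by (intro CollectI, elim summable_comparison_test'[where N = 0]) simp
qed (simp add: ell1_def)

lemma abel_scale_ell1:
  assumes "x \<in> ell_inf" "0 < s" "s < 1"
  shows "abel_scale s x \<in> ell1"
proof -
  obtain B where B: "\<And>n. cmod (x n) \<le> B"
    using assms(1) unfolding ell_inf_def bounded_iff by auto
  have "summable (\<lambda>n. s ^ n * B)"
    using assms by (intro summable_mult2 summable_geometric) simp
  then show ?thesis
    unfolding ell1_def abel_scale_def
  proof (intro CollectI, elim summable_comparison_test'[where N = 0])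
    show "norm (cmod (of_real (s ^ n) * x n)) \<le> s ^ n * B" for n
      using B[of n] assms(2) by (simp add: norm_mult norm_power mult_left_mono)
  qed
qed

lemma abel_scale_lincomb:
  "abel_scale s (\<lambda>i. a * x i + b * y i) = (\<lambda>i. a * abel_scale s x i + b * abel_scale s y i)"
  by (simp add: abel_scale_def algebra_simps)

lemma norm_fourier [simp]: "cmod (fourier n x) = 1"
  by (simp add: fourier_def)

lemma fourier_measurable:
  assumes "finite_borel_01 M"
  shows "fourier n \<in> borel_measurable M"
proof -
  have "continuous_on UNIV (fourier n)"
    unfolding fourier_def cis_conv_exp by (intro continuous_intros)
  then have "fourier n \<in> borel_measurable (restrict_space borel {0..<1})"
    by (intro measurable_restrict_space1 borel_measurable_continuous_onI)
  moreover have "sets M = sets (restrict_space borel {0..<1})"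
    using assms by (simp add: finite_borel_01_def)
  ultimately show ?thesis
    using measurable_cong_sets by blast
qed

lemma L2_bounded:
  assumes "finite_borel_01 M" "f \<in> borel_measurable M" "\<And>x. cmod (f x) \<le> B"
  shows "f \<in> L2 M"
proof (rule L2_I_bound[OF assms(2)])
  interpret finite_measure M using assms(1) by (simp add: finite_borel_01_def)
  show "integrable M (\<lambda>_. B\<^sup>2)" by simp
  show "(cmod (f x))\<^sup>2 \<le> B\<^sup>2" for x
    using assms(3) by (intro power_mono) auto
qed

lemma cnj_fourier_L2:
  assumes "finite_borel_01 M"
  shows "(\<lambda>x. cnj (fourier n x)) \<in> L2 M"
  using assms by (intro L2_bounded[where B = 1] borel_measurable_cnj fourier_measurable) simp_all

lemma synthesis_conj_sums:
  assumes "c \<in> ell1"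
  shows "(\<lambda>n. c n * cnj (fourier n x)) sums synthesis_conj c x"
    and "cmod (synthesis_conj c x) \<le> (\<Sum>n. cmod (c n))"
proof -
  have s: "summable (\<lambda>n. cmod (c n * cnj (fourier n x)))"
    using assms by (simp add: norm_mult ell1_def)
  from summable_sums[OF summable_norm_cancel[OF s]]
  show "(\<lambda>n. c n * cnj (fourier n x)) sums synthesis_conj c x"
    by (simp add: synthesis_conj_def)
  show "cmod (synthesis_conj c x) \<le> (\<Sum>n. cmod (c n))"
    using summable_norm[OF s] by (simp add: synthesis_conj_def norm_mult)
qed

lemma synthesis_conj_L2:
  assumes M: "finite_borel_01 M" and c: "c \<in> ell1"
  shows "synthesis_conj c \<in> L2 M"
proof (rule L2_bounded[OF M])
  have [measurable]: "fourier n \<in> borel_measurable M" for n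
    by (rule fourier_measurable[OF M])
  show "synthesis_conj c \<in> borel_measurable M"
    unfolding synthesis_conj_def by measurable
qed (rule synthesis_conj_sums(2)[OF c])

lemma linear_map_synthesis_conj:
  assumes M: "finite_borel_01 M"
  shows "linear_map cnt ell1 M (L2 M) synthesis_conj"
  unfolding linear_map_def
proof (intro conjI ballI allI impI)
  fix f g :: "nat \<Rightarrow> complex" and a b
  assume f: "f \<in> ell1" and g: "g \<in> ell1"
  have "(\<lambda>n. (a * f n + b * g n) * cnj (fourier n x))
      sums (a * synthesis_conj f x + b * synthesis_conj g x)" for x
    using sums_add[OF sums_mult[OF synthesis_conj_sums(1)[OF f], of a x]
        sums_mult[OF synthesis_conj_sums(1)[OF g], of b x]]
    by (simp add: algebra_simps)
  then show "AE k in M. synthesis_conj (\<lambda>i. a * f i + b * g i) k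
      = a * synthesis_conj f k + b * synthesis_conj g k"
    by (simp add: sums_iff synthesis_conj_def)
next
  fix f g :: "nat \<Rightarrow> complex"
  assume "AE i in cnt. f i = g i"
  then have "f = g" by (simp add: AE_count_space fun_eq_iff)
  then show "AE k in M. synthesis_conj f k = synthesis_conj g k" by simp
qed (rule synthesis_conj_L2[OF M])

lemma linear_map_analysis_conj:
  assumes M: "finite_borel_01 M"
  shows "linear_map M (L2 M) cnt ell_inf (analysis_conj M)"
  unfolding linear_map_def
proof (intro conjI ballI allI impI)
  fix f assume f: "f \<in> L2 M"
  have "cmod (analysis_conj M f n) \<le> L2_norm M f * L2_norm M (\<lambda>_. 1)" for n
    using L2_Cauchy_Schwarz[OF f cnj_fourier_L2[OF M, of n]]
    by (simp add: analysis_conj_def L2_norm_def)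
  then show "analysis_conj M f \<in> ell_inf"
    unfolding ell_inf_def by (intro CollectI boundedI) auto
next
  fix f g assume "f \<in> L2 M" "g \<in> L2 M" "AE i in M. f i = g i"
  then have "analysis_conj M f = analysis_conj M g"
    unfolding analysis_conj_def by (intro ext L2_inner_cong_AE cnj_fourier_L2 M)
  then show "AE k in cnt. analysis_conj M f k = analysis_conj M g k" by simp
next
  fix f g a b assume "f \<in> L2 M" "g \<in> L2 M"
  then show "AE k in cnt. analysis_conj M (\<lambda>i. a * f i + b * g i) k
      = a * analysis_conj M f k + b * analysis_conj M g k"
    by (simp add: AE_count_space analysis_conj_def L2_inner_lincomb_left cnj_fourier_L2[OF M])
qed

text \<open>Analysis is the adjoint of synthesis. Termwise integration is justified by the majorant
  \<open>cmod (c n) * cmod (f x)\<close>: the measure is finite, so the constant 1 is square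
  integrable and \<open>f\<close> is integrable.\<close>

lemma L2_inner_synthesis_conj:
  assumes M: "finite_borel_01 M" and f: "f \<in> L2 M" and c: "c \<in> ell1"
  shows "(\<lambda>n. analysis_conj M f n * cnj (c n)) sums L2_inner M f (synthesis_conj c)"
proof -
  interpret finite_measure M using M by (simp add: finite_borel_01_def)
  define F where "F n x = f x * cnj (c n * cnj (fourier n x))" for n x
  have const: "(\<lambda>_. 1) \<in> L2 M" by (rule L2_bounded[OF M, where B = 1]) auto
  have intf: "integrable M f"
    using L2_inner_integrable[OF f const] by simp
  have F_eq: "F n x = cnj (c n) * (f x * cnj (cnj (fourier n x)))" for n x
    by (simp add: F_def)
  have int: "integrable M (F n)" for n
    unfolding F_eq by (intro integrable_mult_right L2_inner_integrable f cnj_fourier_L2 M)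
  have normF: "norm (F n x) = cmod (c n) * cmod (f x)" for n x
    by (simp add: F_def norm_mult)
  have sc: "summable (\<lambda>n. cmod (c n))" using c by (simp add: ell1_def)
  have "(\<lambda>n. integral\<^sup>L M (F n)) sums (LINT x|M. (\<Sum>n. F n x))"
    by (rule sums_integral[OF int]) (simp_all add: normF summable_mult2[OF sc])
  moreover have "integral\<^sup>L M (F n) = analysis_conj M f n * cnj (c n)" for n
    unfolding F_eq by (simp add: analysis_conj_def L2_inner_def)
  moreover have "(\<Sum>n. F n x) = f x * cnj (synthesis_conj c x)" for x
    using sums_mult[OF iffD2[OF sums_cnj synthesis_conj_sums(1)[OF c]], of "f x" x]
    by (simp add: F_def sums_iff)
  ultimately show ?thesis by (simp add: L2_inner_def)
qed

text \<open>Each factor is moved to the other side: \<open>C\<close> is self-adjoint, the Abel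
  weights are real and diagonal, and analysis is the adjoint of synthesis.\<close>

lemma op_Abel_analysis_eq:
  assumes C: "bounded_op_ell2 C" "positive_op_ell2 C" and M: "finite_borel_01 M"
    and f: "f \<in> L2 M" and x: "x \<in> ell2" and s: "0 < s" "s < 1"
  shows "ell2_inner (C (abel_scale s (analysis_conj M f))) x
    = L2_inner M f (synthesis_conj (abel_scale s (C x)))"
proof -
  have c: "abel_scale s (analysis_conj M f) \<in> ell2"
    by (intro ell1_ell2 abel_scale_ell1 linear_map_memD[OF linear_map_analysis_conj] M f s)
  have Cx: "C x \<in> ell2" by (rule ell2_op_mem[OF C(1) x])
  have "ell2_inner (C (abel_scale s (analysis_conj M f))) x
      = (\<Sum>n. abel_scale s (analysis_conj M f) n * cnj (C x n))"
    unfolding positive_op_selfadjoint[OF C c x] by (rule ell2_inner_eq[OF c Cx])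
  also have "\<dots> = (\<Sum>n. analysis_conj M f n * cnj (abel_scale s (C x) n))"
    by (simp add: abel_scale_def mult_ac)
  also have "\<dots> = L2_inner M f (synthesis_conj (abel_scale s (C x)))"
    using L2_inner_synthesis_conj[OF M f abel_scale_ell1[OF ell2_ell_inf[OF Cx] s]]
    by (simp add: sums_iff)
  finally show ?thesis .
qed

text \<open>Self-adjointness turns the kernel into the product of \<open>power_vec z\<close> with
  \<open>C (power_vec w)\<close>. On a circle of radius \<open>r\<close> the powers of
  \<open>z\<close> split into the Abel weight \<open>r ^ n\<close> and \<open>fourier n x\<close>,
  the conjugate of the character used in the synthesis.\<close>

lemma op_kernel_radial:
  assumes C: "bounded_op_ell2 C" "positive_op_ell2 C" and w: "w \<in> ball 0 1" and r: "0 < r" "r < 1"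
  shows "op_kernel C w (of_real r * cis (2 * pi * x))
    = cnj (synthesis_conj (abel_scale r (C (power_vec w))) x)"
proof -
  define z where "z = of_real r * cis (2 * pi * x)"
  have z: "z \<in> ball 0 1" using r by (simp add: z_def norm_mult)
  have Cw: "C (power_vec w) \<in> ell2" by (rule ell2_op_mem[OF C(1) power_vec_ell2[OF w]])
  have pw: "power_vec z n = of_real (r ^ n) * fourier n x" for n
  proof -
    have "real n * (2 * pi * x) = 2 * pi * real n * x" by (simp add: mult_ac)
    then show ?thesis
      by (simp only: z_def power_vec_def fourier_def power_mult_distrib Complex.DeMoivre of_real_power)
  qed
  have "op_kernel C w z = (\<Sum>n. power_vec z n * cnj (C (power_vec w) n))"
    unfolding op_kernel_def positive_op_selfadjoint[OF C power_vec_ell2[OF z] power_vec_ell2[OF w]]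
    by (rule ell2_inner_eq[OF power_vec_ell2[OF z] Cw])
  also have "\<dots> = (\<Sum>n. cnj (abel_scale r (C (power_vec w)) n * cnj (fourier n x)))"
    by (rule arg_cong[where f = suminf], rule ext) (simp add: pw abel_scale_def)
  also have "\<dots> = cnj (synthesis_conj (abel_scale r (C (power_vec w))) x)"
    using iffD2[OF sums_cnj synthesis_conj_sums(1)[OF abel_scale_ell1[OF ell2_ell_inf[OF Cw] r], of x]]
    by (simp add: sums_iff)
  finally show ?thesis by (simp add: z_def)
qed

subsection \<open>Weak Abel limits\<close>

text \<open>The limit common to both sides of the equivalence: it is the boundary condition up to
  conjugation, and the convergence clause of the first Abel product at a single vector.\<close>

definition weak_Abel_limit ::
  "real measure \<Rightarrow> (nat \<Rightarrow> complex) \<Rightarrow> (real \<Rightarrow> complex) \<Rightarrow> bool" where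
  "weak_Abel_limit M x g \<longleftrightarrow> g \<in> L2 M \<and>
    (\<forall>h\<in>L2 M. ((\<lambda>s. L2_inner M (synthesis_conj (abel_scale s x)) h) \<longlongrightarrow> L2_inner M g h) (at_left 1))"

lemma eventually_at_left_1: "eventually (\<lambda>s::real. 0 < s \<and> s < 1) (at_left 1)"
  by (rule eventually_at_leftI[of 0]) auto

lemma weak_Abel_limit_unique:
  assumes "weak_Abel_limit M x g" "weak_Abel_limit M x g'"
  shows "AE t in M. g t = g' t"
proof (rule L2_eq_AE_I)
  show "L2_inner M g h = L2_inner M g' h" if "h \<in> L2 M" for h
  proof (rule tendsto_unique[OF trivial_limit_at_left_real])
    let ?S = "\<lambda>s. L2_inner M (synthesis_conj (abel_scale s x)) h"
    show "(?S \<longlongrightarrow> L2_inner M g h) (at_left 1)" "(?S \<longlongrightarrow> L2_inner M g' h) (at_left 1)"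
      using assms that by (simp_all add: weak_Abel_limit_def)
  qed
qed (use assms in \<open>auto simp: weak_Abel_limit_def\<close>)

lemma weak_Abel_limit_lincomb:
  assumes M: "finite_borel_01 M" and x: "x \<in> ell_inf" and y: "y \<in> ell_inf"
    and g: "weak_Abel_limit M x g" and h: "weak_Abel_limit M y h"
  shows "weak_Abel_limit M (\<lambda>i. a * x i + b * y i) (\<lambda>t. a * g t + b * h t)"
  unfolding weak_Abel_limit_def
proof (intro conjI ballI)
  have g2: "g \<in> L2 M" and h2: "h \<in> L2 M" using g h by (auto simp: weak_Abel_limit_def)
  then show "(\<lambda>t. a * g t + b * h t) \<in> L2 M" by (rule L2_lincomb)
  fix k assume k: "k \<in> L2 M"
  let ?S = "\<lambda>x s. L2_inner M (synthesis_conj (abel_scale s x)) k"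
  have "((\<lambda>s. a * ?S x s + b * ?S y s) \<longlongrightarrow> a * L2_inner M g k + b * L2_inner M h k) (at_left 1)"
    using g h k unfolding weak_Abel_limit_def by (intro tendsto_intros) auto
  \<comment> \<open>Scaled sequences are summable only for \<open>s\<close> between 0 and 1, so
    linearity of the synthesis is available only eventually.\<close>
  moreover have "eventually (\<lambda>s. ?S (\<lambda>i. a * x i + b * y i) s = a * ?S x s + b * ?S y s) (at_left 1)"
    using eventually_at_left_1
  proof eventually_elim
    case (elim s)
    then show ?case
      unfolding abel_scale_lincomb
      by (intro linear_map_inner_left[OF linear_map_synthesis_conj[OF M] csubspace_ell1] k
          abel_scale_ell1 x y) auto
  qed
  ultimately show "(?S (\<lambda>i. a * x i + b * y i)
      \<longlongrightarrow> L2_inner M (\<lambda>t. a * g t + b * h t) k) (at_left 1)"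
    by (simp add: L2_inner_lincomb_left[OF g2 h2 k] tendsto_cong)
qed

text \<open>The radial functions are the conjugates of the Abel sums, and conjugating both arguments
  conjugates an inner product.\<close>

lemma has_L2_boundary_iff_weak_Abel_limit:
  assumes C: "bounded_op_ell2 C" "positive_op_ell2 C" and M: "finite_borel_01 M"
    and w: "w \<in> ball 0 1"
  shows "has_L2_boundary M (op_kernel C w) (\<lambda>t. cnj (g t)) \<longleftrightarrow>
    weak_Abel_limit M (C (power_vec w)) g"
proof -
  define K where "K r x = op_kernel C w (of_real r * cis (2 * pi * x))" for r x
  define S where "S r = synthesis_conj (abel_scale r (C (power_vec w)))" for r
  have Cw: "C (power_vec w) \<in> ell2" by (rule ell2_op_mem[OF C(1) power_vec_ell2[OF w]])
  have K: "K r = (\<lambda>x. cnj (S r x))" if "0 < r" "r < 1" for r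
    by (rule ext) (simp add: K_def S_def op_kernel_radial[OF C w that])
  have S2: "S r \<in> L2 M" if "0 < r" "r < 1" for r
    unfolding S_def using synthesis_conj_L2[OF M abel_scale_ell1[OF ell2_ell_inf[OF Cw] that]] .
  have ev: "eventually (\<lambda>r. L2_inner M (K r) h = cnj (L2_inner M (S r) (\<lambda>t. cnj (h t)))) (at_left 1)"
    for h
    using eventually_at_left_1
  proof eventually_elim
    case (elim r)
    then show ?case
      using L2_inner_cnj_cnj[of M "S r" "\<lambda>t. cnj (h t)"] K[of r] by simp
  qed
  have lim: "((\<lambda>r. L2_inner M (K r) h) \<longlongrightarrow> L2_inner M (\<lambda>t. cnj (g t)) h) (at_left 1) \<longleftrightarrow>
      ((\<lambda>r. L2_inner M (S r) (\<lambda>t. cnj (h t))) \<longlongrightarrow> L2_inner M g (\<lambda>t. cnj (h t))) (at_left 1)" for h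
    unfolding tendsto_cong[OF ev]
    using L2_inner_cnj_cnj[of M g "\<lambda>t. cnj (h t)"] by (simp add: lim_cnj)
  have gL: "(\<lambda>t. cnj (g t)) \<in> L2 M \<longleftrightarrow> g \<in> L2 M"
    using L2_cnj[of "\<lambda>t. cnj (g t)" M] L2_cnj[of g M] unfolding complex_cnj_cnj by (rule iffI)
  let ?lim = "\<lambda>h. ((\<lambda>r. L2_inner M (S r) h) \<longlongrightarrow> L2_inner M g h) (at_left 1)"
  \<comment> \<open>Conjugation maps \<open>L2 M\<close> onto itself, so the conjugates exhaust the
    test functions.\<close>
  have reindex: "(\<forall>h\<in>L2 M. ?lim (\<lambda>t. cnj (h t))) \<longleftrightarrow> (\<forall>h\<in>L2 M. ?lim h)"
  proof (intro iffI ballI)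
    fix h assume "\<forall>h\<in>L2 M. ?lim (\<lambda>t. cnj (h t))" and "h \<in> L2 M"
    then have "?lim (\<lambda>t. cnj (cnj (h t)))"
      by (rule bspec[OF _ L2_cnj])
    then show "?lim h" by simp
  next
    fix h assume "\<forall>h\<in>L2 M. ?lim h" and "h \<in> L2 M"
    then show "?lim (\<lambda>t. cnj (h t))" by (rule bspec[OF _ L2_cnj])
  qed
  have K2: "\<forall>r\<in>{0<..<1}. K r \<in> L2 M"
    using K L2_cnj[OF S2] by simp
  have "has_L2_boundary M (op_kernel C w) (\<lambda>t. cnj (g t)) \<longleftrightarrow>
      g \<in> L2 M \<and> (\<forall>h\<in>L2 M. ?lim h)"
    unfolding has_L2_boundary_def K_def[symmetric] gL lim reindex using K2 by simp
  then show ?thesis unfolding weak_Abel_limit_def S_def .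
qed

section \<open>Extension from the power vectors to their span, and the adjoint\<close>

lemma weak_Abel_limit_V_space:
  assumes C: "bounded_op_ell2 C" and M: "finite_borel_01 M"
    and lim: "\<And>w. w \<in> ball 0 1 \<Longrightarrow> \<exists>g. weak_Abel_limit M (C (power_vec w)) g"
    and v: "v \<in> V_space"
  shows "\<exists>g. weak_Abel_limit M (C v) g"
  using v
proof (induction rule: V_space_induct)
  case (lincomb f g a b)
  then obtain p q where p: "weak_Abel_limit M (C f) p" and q: "weak_Abel_limit M (C g) q"
    by blast
  have fg: "f \<in> ell2" "g \<in> ell2" using lincomb V_space_ell2 by auto
  have "C (\<lambda>i. a * f i + b * g i) = (\<lambda>i. a * C f i + b * C g i)"
    by (rule ext) (rule ell2_op_lincomb[OF C fg])
  then show ?case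
    using weak_Abel_limit_lincomb[OF M _ _ p q, of a b] ell2_ell_inf ell2_op_mem[OF C] fg
    by auto
qed (rule lim)

text \<open>Two inductions on the span: the first slot with a power vector in the second, then the
  second slot, where both sides are conjugate linear.\<close>

lemma V_space_sesquilinear_eq:
  assumes C: "bounded_op_ell2 C" and A: "linear_map cnt V_space M (L2 M) A"
    and eq: "\<And>z w. z \<in> ball 0 1 \<Longrightarrow> w \<in> ball 0 1 \<Longrightarrow>
      L2_inner M (A (power_vec z)) (A (power_vec w)) = ell2_inner (C (power_vec z)) (power_vec w)"
    and u: "u \<in> V_space" and v: "v \<in> V_space"
  shows "L2_inner M (A u) (A v) = ell2_inner (C u) v"
proof -
  have C': "linear_map cnt ell2 cnt ell2 C"
    using C by (simp add: bounded_op_ell2_def bounded_linear_map_def)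
  note C_left = linear_map_inner_left[OF C' csubspace_L2 V_space_ell2 V_space_ell2]
  note A_left = linear_map_inner_left[OF A csubspace_V_space]
  have A2: "A x \<in> L2 M" if "x \<in> V_space" for x
    by (rule linear_map_memD[OF A that])
  have eq_power: "L2_inner M (A x) (A (power_vec w)) = ell2_inner (C x) (power_vec w)"
    if w: "w \<in> ball 0 1" and "x \<in> V_space" for x w
    using that(2)
  proof (induction rule: V_space_induct)
    case (power z)
    then show ?case by (rule eq[OF _ w])
  next
    case (lincomb f g a b)
    then show ?case
      by (simp add: A_left C_left A2 power_vec_V_space[OF w] power_vec_ell2[OF w])
  qed
  have right: "L2_inner M (A u) (A (\<lambda>i. a * f i + b * g i))
      = cnj a * L2_inner M (A u) (A f) + cnj b * L2_inner M (A u) (A g)"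
    if "f \<in> V_space" "g \<in> V_space" for f g a b
    using arg_cong[OF A_left[OF that A2[OF u], of a b], of cnj] by (simp add: L2_inner_cnj)
  show ?thesis
    using v
  proof (induction rule: V_space_induct)
    case (power w)
    then show ?case by (rule eq_power[OF _ u])
  next
    case (lincomb f g a b)
    then show ?case
      by (simp add: right L2_inner_lincomb_right V_space_ell2 ell2_op_mem[OF C V_space_ell2[OF u]])
  qed
qed

text \<open>For fixed \<open>f\<close>, the product of \<open>A v\<close> with \<open>f\<close> is a
  bounded functional of \<open>v\<close> on the span, and \<open>V_space_Riesz\<close> supplies the
  vector \<open>B f\<close>.\<close>

lemma V_space_adjoint:
  assumes A: "bounded_linear_map cnt V_space M A"
  obtains B where "bounded_linear_map M (L2 M) cnt B"
    "\<And>f v. f \<in> L2 M \<Longrightarrow> v \<in> V_space \<Longrightarrow> ell2_inner (B f) v = L2_inner M f (A v)"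
proof -
  have A': "linear_map cnt V_space M (L2 M) A"
    using A by (simp add: bounded_linear_map_def)
  obtain K where K: "0 \<le> K" "\<And>v. v \<in> V_space \<Longrightarrow> L2_norm M (A v) \<le> K * L2_norm cnt v"
    using bounded_linear_map_bound[OF A] by blast
  have "\<exists>b. b \<in> ell2 \<and> L2_norm cnt b \<le> K * L2_norm M f \<and>
      (\<forall>v\<in>V_space. ell2_inner v b = L2_inner M (A v) f)" if f: "f \<in> L2 M" for f
  proof (rule V_space_Riesz[where \<phi> = "\<lambda>v. L2_inner M (A v) f" and M = "K * L2_norm M f"])
    fix v assume v: "v \<in> V_space"
    have "cmod (L2_inner M (A v) f) \<le> L2_norm M (A v) * L2_norm M f"
      by (rule L2_Cauchy_Schwarz[OF linear_map_memD[OF A' v] f])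
    also have "\<dots> \<le> K * L2_norm cnt v * L2_norm M f"
      by (intro mult_right_mono K v L2_norm_nonneg)
    finally show "cmod (L2_inner M (A v) f) \<le> K * L2_norm M f * L2_norm cnt v"
      by (simp add: mult_ac)
  qed (use K(1) L2_norm_nonneg[of M f] linear_map_inner_left[OF A' csubspace_V_space _ _ f] in auto)
  then obtain B where B: "\<And>f. f \<in> L2 M \<Longrightarrow> B f \<in> ell2"
      "\<And>f. f \<in> L2 M \<Longrightarrow> L2_norm cnt (B f) \<le> K * L2_norm M f"
      "\<And>f v. f \<in> L2 M \<Longrightarrow> v \<in> V_space \<Longrightarrow> ell2_inner v (B f) = L2_inner M (A v) f"
    by metis
  have adj: "ell2_inner (B f) v = L2_inner M f (A v)" if "f \<in> L2 M" "v \<in> V_space" for f v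
    using arg_cong[OF B(3)[OF that], of cnj] by (simp add: L2_inner_cnj)
  \<comment> \<open>\<open>B f\<close> was chosen separately for each \<open>f\<close>. Linearity
    and compatibility with null sets follow because products with the span determine a
    vector.\<close>
  have "linear_map M (L2 M) cnt ell2 B"
    unfolding linear_map_def
  proof (intro conjI ballI allI impI)
    fix f g assume f: "f \<in> L2 M" and g: "g \<in> L2 M" and fg: "AE x in M. f x = g x"
    have "B f = B g"
      using f g fg by (intro V_space_inner_eqD B(1))
        (auto simp: adj intro!: L2_inner_cong_AE linear_map_memD[OF A'])
    then show "AE k in cnt. B f k = B g k" by simp
  next
    fix f g a b assume f: "f \<in> L2 M" and g: "g \<in> L2 M"
    have "B (\<lambda>i. a * f i + b * g i) = (\<lambda>i. a * B f i + b * B g i)"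
    proof (intro V_space_inner_eqD B(1) L2_lincomb f g)
      fix v assume v: "v \<in> V_space"
      show "ell2_inner (B (\<lambda>i. a * f i + b * g i)) v = ell2_inner (\<lambda>i. a * B f i + b * B g i) v"
        by (simp only: adj[OF L2_lincomb[OF f g] v] adj[OF f v] adj[OF g v]
            L2_inner_lincomb_left[OF f g linear_map_memD[OF A' v]]
            L2_inner_lincomb_left[OF B(1)[OF f] B(1)[OF g] V_space_ell2[OF v]])
    qed
    then show "AE k in cnt. B (\<lambda>i. a * f i + b * g i) k = a * B f k + b * B g k" by simp
  qed (rule B(1))
  then have "bounded_linear_map M (L2 M) cnt B"
    unfolding bounded_linear_map_def using B(2) by blast
  then show ?thesis using adj by (rule that)
qed

text \<open>By \<open>op_Abel_analysis_eq\<close> the expression is the conjugate of one whose limit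
  is given by \<open>g\<close>: convergence of the first Abel product is passed on to the
  second.\<close>

lemma tendsto_Abel_analysis:
  assumes C: "bounded_op_ell2 C" "positive_op_ell2 C" and M: "finite_borel_01 M"
    and f: "f \<in> L2 M" and x: "x \<in> ell2" and g: "weak_Abel_limit M (C x) g"
  shows "((\<lambda>s. ell2_inner (C (abel_scale s (analysis_conj M f))) x) \<longlongrightarrow> L2_inner M f g) (at_left 1)"
proof -
  have "((\<lambda>s. cnj (L2_inner M (synthesis_conj (abel_scale s (C x))) f)) \<longlongrightarrow> cnj (L2_inner M g f)) (at_left 1)"
    using g f by (simp add: lim_cnj weak_Abel_limit_def)
  moreover have "eventually (\<lambda>s. ell2_inner (C (abel_scale s (analysis_conj M f))) x
      = cnj (L2_inner M (synthesis_conj (abel_scale s (C x))) f)) (at_left 1)"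
    using eventually_at_left_1
    by eventually_elim (simp add: op_Abel_analysis_eq[OF C M f x] L2_inner_cnj)
  ultimately show ?thesis
    by (simp add: tendsto_cong L2_inner_cnj)
qed

section \<open>The two Abel products\<close>

text \<open>Settles the domain conditions once: \<open>C\<close> sends the span to bounded
  sequences, and Abel scaling makes these summable. Boundedness and the weak limits remain.\<close>

lemma is_abel_product_synthesis_iff:
  assumes C: "bounded_op_ell2 C" and M: "finite_borel_01 M"
  shows "is_abel_product cnt V_space M (L2 M) ell1 synthesis_conj C A \<longleftrightarrow>
    bounded_linear_map cnt V_space M A \<and> (\<forall>v\<in>V_space. weak_Abel_limit M (C v) (A v))"
proof -
  have inf: "C v \<in> ell_inf" if "v \<in> V_space" for v
    by (intro ell2_ell_inf ell2_op_mem[OF C] V_space_ell2 that)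
  have "linear_map cnt V_space cnt ell_inf C"
    using C inf V_space_ell2
    unfolding bounded_op_ell2_def bounded_linear_map_def linear_map_def by blast
  then show ?thesis
    unfolding is_abel_product_def weak_Abel_limit_def
    using csubspace_V_space csubspace_L2 csubspace_ell1 linear_map_synthesis_conj[OF M]
      V_space_ell2 abel_scale_ell1[OF inf]
    by (auto simp: bounded_linear_map_def dest: linear_map_memD)
qed

text \<open>The same reduction, with \<open>C\<close> now restricted to \<open>ell1\<close>, a part
  of \<open>ell2\<close>.\<close>

lemma is_abel_product_analysis_iff:
  assumes C: "bounded_op_ell2 C" and M: "finite_borel_01 M"
  shows "is_abel_product M (L2 M) cnt V_space ell1 C (analysis_conj M) B \<longleftrightarrow>
    bounded_linear_map M (L2 M) cnt B \<and>
    (\<forall>f\<in>L2 M. \<forall>v\<in>V_space. ((\<lambda>s. ell2_inner (C (abel_scale s (analysis_conj M f))) v)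
      \<longlongrightarrow> ell2_inner (B f) v) (at_left 1))"
proof -
  note an = linear_map_analysis_conj[OF M]
  have "linear_map cnt ell1 cnt ell2 C"
    using C ell1_ell2
    unfolding bounded_op_ell2_def bounded_linear_map_def linear_map_def by blast
  then show ?thesis
    unfolding is_abel_product_def
    using csubspace_V_space csubspace_L2 csubspace_ell1 an
      V_space_ell2 abel_scale_ell1[OF linear_map_memD[OF an]]
    by auto
qed

section \<open>Boundary measures and the factorization of \<open>C\<close> through
  \<open>L2 \<mu>\<close>\<close>

theorem theorem2:
  fixes C :: "(nat \<Rightarrow> complex) \<Rightarrow> (nat \<Rightarrow> complex)" and \<mu> :: "real measure"
  assumes "bounded_op_ell2 C" and "positive_op_ell2 C" and "finite_borel_01 \<mu>"
  shows "\<mu> \<in> boundary_measures (op_kernel C) \<longleftrightarrow>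
    (\<exists>A B. is_abel_product cnt V_space \<mu> (L2 \<mu>) ell1 synthesis_conj C A \<and>
           is_abel_product \<mu> (L2 \<mu>) cnt V_space ell1 C (analysis_conj \<mu>) B \<and>
           (\<forall>v\<in>V_space. \<forall>y\<in>ell2. ell2_inner (C v) y = ell2_inner (B (A v)) y))"
proof
  note C = assms(1,2) and \<mu> = assms(3)
  assume "\<mu> \<in> boundary_measures (op_kernel C)"
  then obtain K where K: "\<And>w. w \<in> ball 0 1 \<Longrightarrow> has_L2_boundary \<mu> (op_kernel C w) (K w)"
    and KK: "\<And>z w. z \<in> ball 0 1 \<Longrightarrow> w \<in> ball 0 1 \<Longrightarrow>
      op_kernel C w z = (LINT x|\<mu>. K w x * cnj (K z x))"
    unfolding boundary_measures_def by blast
  have K_lim: "weak_Abel_limit \<mu> (C (power_vec w)) (\<lambda>x. cnj (K w x))" if w: "w \<in> ball 0 1" for w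
    using has_L2_boundary_iff_weak_Abel_limit[OF C \<mu> w, of "\<lambda>x. cnj (K w x)"] K[OF w] by simp
  have "\<exists>g. weak_Abel_limit \<mu> (C v) g" if "v \<in> V_space" for v
    using weak_Abel_limit_V_space[OF C(1) \<mu> _ that] K_lim by blast
  then obtain A where A: "\<And>v. v \<in> V_space \<Longrightarrow> weak_Abel_limit \<mu> (C v) (A v)"
    by metis
  have A2: "A v \<in> L2 \<mu>" if "v \<in> V_space" for v
    using A[OF that] by (simp add: weak_Abel_limit_def)
  \<comment> \<open>\<open>A\<close> is a mere choice of weak limits; their uniqueness makes it
    linear modulo null sets.\<close>
  have A_lin: "linear_map cnt V_space \<mu> (L2 \<mu>) A"
    unfolding linear_map_def
  proof (intro conjI ballI allI impI)
    fix f g :: "nat \<Rightarrow> complex" assume "AE i in cnt. f i = g i"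
    then have "f = g" by (simp add: AE_count_space fun_eq_iff)
    then show "AE x in \<mu>. A f x = A g x" by simp
  next
    fix f g a b assume f: "f \<in> V_space" and g: "g \<in> V_space"
    have fg: "f \<in> ell2" "g \<in> ell2" using f g V_space_ell2 by auto
    have "C (\<lambda>i. a * f i + b * g i) = (\<lambda>i. a * C f i + b * C g i)"
      by (rule ext) (rule ell2_op_lincomb[OF C(1) fg])
    moreover have "weak_Abel_limit \<mu> (\<lambda>i. a * C f i + b * C g i) (\<lambda>x. a * A f x + b * A g x)"
      by (intro weak_Abel_limit_lincomb \<mu> ell2_ell_inf ell2_op_mem[OF C(1)] fg A f g)
    ultimately show "AE x in \<mu>. A (\<lambda>i. a * f i + b * g i) x = a * A f x + b * A g x"
      using A[OF V_space_lincomb[OF f g, of a b]] by (auto intro: weak_Abel_limit_unique)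
  qed (rule A2)
  have form: "L2_inner \<mu> (A u) (A v) = ell2_inner (C u) v" if "u \<in> V_space" "v \<in> V_space" for u v
  proof (rule V_space_sesquilinear_eq[OF C(1) A_lin _ that])
    fix z w :: complex assume z: "z \<in> ball 0 1" and w: "w \<in> ball 0 1"
    have AK: "AE x in \<mu>. A (power_vec w) x = cnj (K w x)" if "w \<in> ball 0 1" for w
      by (rule weak_Abel_limit_unique[OF A[OF power_vec_V_space[OF that]] K_lim[OF that]])
    \<comment> \<open>As \<open>A (power_vec w)\<close> is the conjugate of \<open>K w\<close>, the
      two factors trade places.\<close>
    have "L2_inner \<mu> (A (power_vec z)) (A (power_vec w)) = (LINT x|\<mu>. K w x * cnj (K z x))"
      unfolding L2_inner_def
    proof (rule integral_cong_AE)
      show "AE x in \<mu>. A (power_vec z) x * cnj (A (power_vec w) x) = K w x * cnj (K z x)"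
        using AK[OF z] AK[OF w] by eventually_elim simp
      have "K z \<in> L2 \<mu>" "K w \<in> L2 \<mu>" using K z w by (auto simp: has_L2_boundary_def)
      then show "(\<lambda>x. K w x * cnj (K z x)) \<in> borel_measurable \<mu>"
        by (intro borel_measurable_integrable L2_inner_integrable)
    qed (intro borel_measurable_integrable L2_inner_integrable A2 power_vec_V_space z w)
    then show "L2_inner \<mu> (A (power_vec z)) (A (power_vec w)) = ell2_inner (C (power_vec z)) (power_vec w)"
      using KK[OF z w] by (simp add: op_kernel_def)
  qed
  have A_bd: "bounded_linear_map cnt V_space \<mu> A"
  proof -
    obtain k where k: "0 \<le> k" "\<And>f. f \<in> ell2 \<Longrightarrow> L2_norm cnt (C f) \<le> k * L2_norm cnt f"
      using C(1) bounded_linear_map_bound unfolding bounded_op_ell2_def by blast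
    \<comment> \<open>By \<open>form\<close> the squared norm of \<open>A v\<close> equals the
      quadratic form of \<open>C\<close> at \<open>v\<close>; hence the square root of the bound for
      \<open>C\<close>.\<close>
    have "L2_norm \<mu> (A v) \<le> sqrt k * L2_norm cnt v" if v: "v \<in> V_space" for v
    proof (rule power2_le_imp_le)
      have v2: "v \<in> ell2" by (rule V_space_ell2[OF v])
      have "(L2_norm \<mu> (A v))\<^sup>2 = cmod (ell2_inner (C v) v)"
        unfolding form[OF v v, symmetric] L2_inner_self norm_of_real by simp
      also have "\<dots> \<le> L2_norm cnt (C v) * L2_norm cnt v"
        by (rule L2_Cauchy_Schwarz[OF ell2_op_mem[OF C(1) v2] v2])
      also have "\<dots> \<le> k * L2_norm cnt v * L2_norm cnt v"
        by (intro mult_right_mono k v2 L2_norm_nonneg)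
      finally show "(L2_norm \<mu> (A v))\<^sup>2 \<le> (sqrt k * L2_norm cnt v)\<^sup>2"
        using k(1) by (simp add: power_mult_distrib mult.assoc flip: power2_eq_square)
    qed (use k(1) L2_norm_nonneg[of cnt v] in simp)
    then show ?thesis unfolding bounded_linear_map_def using A_lin by blast
  qed
  obtain B where B: "bounded_linear_map \<mu> (L2 \<mu>) cnt B"
    and adj: "\<And>f v. f \<in> L2 \<mu> \<Longrightarrow> v \<in> V_space \<Longrightarrow> ell2_inner (B f) v = L2_inner \<mu> f (A v)"
    using V_space_adjoint[OF A_bd] by blast
  have B2: "B f \<in> ell2" if "f \<in> L2 \<mu>" for f
    using B that unfolding bounded_linear_map_def by (blast dest: linear_map_memD)
  \<comment> \<open>Tested against \<open>u\<close> in the span, the right side becomes the product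
    of \<open>A v\<close> and \<open>A u\<close>, which \<open>form\<close> identifies with the left
    side.\<close>
  have "C v = B (A v)" if v: "v \<in> V_space" for v
    by (rule V_space_inner_eqD)
      (simp_all add: adj form A2 B2 v ell2_op_mem[OF C(1) V_space_ell2[OF v]])
  moreover have "is_abel_product cnt V_space \<mu> (L2 \<mu>) ell1 synthesis_conj C A"
    using A A_bd by (simp add: is_abel_product_synthesis_iff[OF C(1) \<mu>])
  moreover have "is_abel_product \<mu> (L2 \<mu>) cnt V_space ell1 C (analysis_conj \<mu>) B"
    using B tendsto_Abel_analysis[OF C \<mu> _ V_space_ell2 A]
    by (simp add: is_abel_product_analysis_iff[OF C(1) \<mu>] adj)
  ultimately show "\<exists>A B. is_abel_product cnt V_space \<mu> (L2 \<mu>) ell1 synthesis_conj C A \<and>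
      is_abel_product \<mu> (L2 \<mu>) cnt V_space ell1 C (analysis_conj \<mu>) B \<and>
      (\<forall>v\<in>V_space. \<forall>y\<in>ell2. ell2_inner (C v) y = ell2_inner (B (A v)) y)"
    by (intro exI[of _ A] exI[of _ B]) simp
next
  note C = assms(1,2) and \<mu> = assms(3)
  assume "\<exists>A B. is_abel_product cnt V_space \<mu> (L2 \<mu>) ell1 synthesis_conj C A \<and>
      is_abel_product \<mu> (L2 \<mu>) cnt V_space ell1 C (analysis_conj \<mu>) B \<and>
      (\<forall>v\<in>V_space. \<forall>y\<in>ell2. ell2_inner (C v) y = ell2_inner (B (A v)) y)"
  then obtain A B where A: "\<And>v. v \<in> V_space \<Longrightarrow> weak_Abel_limit \<mu> (C v) (A v)"
    and B: "\<And>f v. f \<in> L2 \<mu> \<Longrightarrow> v \<in> V_space \<Longrightarrow>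
      ((\<lambda>s. ell2_inner (C (abel_scale s (analysis_conj \<mu> f))) v) \<longlongrightarrow> ell2_inner (B f) v) (at_left 1)"
    and CBA: "\<And>v y. v \<in> V_space \<Longrightarrow> y \<in> ell2 \<Longrightarrow> ell2_inner (C v) y = ell2_inner (B (A v)) y"
    unfolding is_abel_product_synthesis_iff[OF C(1) \<mu>] is_abel_product_analysis_iff[OF C(1) \<mu>]
    by blast
  \<comment> \<open>The limit that determines \<open>B\<close> is computed again through
    \<open>A\<close>; uniqueness of limits makes \<open>B\<close> the adjoint of
    \<open>A\<close>.\<close>
  have adj: "ell2_inner (B f) v = L2_inner \<mu> f (A v)" if f: "f \<in> L2 \<mu>" and v: "v \<in> V_space" for f v
    by (rule tendsto_unique[OF trivial_limit_at_left_real B[OF f v]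
          tendsto_Abel_analysis[OF C \<mu> f V_space_ell2[OF v] A[OF v]]])
  define K where "K w x = cnj (A (power_vec w) x)" for w x
  have "has_L2_boundary \<mu> (op_kernel C w) (K w)" if w: "w \<in> ball 0 1" for w
    unfolding K_def[abs_def] has_L2_boundary_iff_weak_Abel_limit[OF C \<mu> w]
    by (rule A[OF power_vec_V_space[OF w]])
  moreover have "op_kernel C w z = (LINT x|\<mu>. K w x * cnj (K z x))"
    if z: "z \<in> ball 0 1" and w: "w \<in> ball 0 1" for z w
  proof -
    have "A (power_vec z) \<in> L2 \<mu>"
      using A[OF power_vec_V_space[OF z]] by (simp add: weak_Abel_limit_def)
    \<comment> \<open>The factorization at \<open>y = power_vec w\<close>, then \<open>adj\<close>
      with \<open>f = A (power_vec z)\<close>.\<close>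
    then have "op_kernel C w z = L2_inner \<mu> (A (power_vec z)) (A (power_vec w))"
      unfolding op_kernel_def
      using CBA[OF power_vec_V_space[OF z] power_vec_ell2[OF w]] adj power_vec_V_space[OF w]
      by simp
    then show ?thesis by (simp add: L2_inner_def K_def mult.commute)
  qed
  ultimately show "\<mu> \<in> boundary_measures (op_kernel C)"
    unfolding boundary_measures_def using \<mu> by blast
qed

end
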